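(* Let $a\colon\mathbb N_0\to\mathbb C$ be an automatic sequence produced by a strongly connected, prolongable automaton. Then there exists a decomposition $a(n)=a_{\mathrm{str}}(n)+a_{\mathrm{uni}}(n)$ for all $n\in\mathbb N_0$, where $a_{\mathrm{str}}$ is rationally almost periodic and $a_{\mathrm{uni}}$ is highly Gowers uniform.
   Context: For $k\ge2$, $\Sigma_k=\{0,\dots,k-1\}$, $\Sigma_k^*$ is the set of finite words over $\Sigma_k$, and $(n)_k$ is the base-$k$ expansion of $n\in\mathbb N_0$ without leading zeros. A $k$-automaton $(S,s_0,\Sigma_k,\delta,\Omega,\tau)$ has a finite state set $S$, initial state $s_0$, transition function $\delta\colon S\times\Sigma_k\to S$ (extended to words by $\delta(s,\mathbf{uv})=\delta(\delta(s,\mathbf u),\mathbf v)$) and output function $\tau\colon S\to\Omega$; it produces $a(n)=\tau(\delta(s_0,(n)_k))$. It is prolongable if $\delta(s_0,0)=s_0$, and strongly connected if for any $s,s'\in S$ there is $\mathbf w\in\Sigma_k^*$ with $\delta(s,\mathbf w)=s'$. A sequence $x\colon\mathbb N_0\to\Omega$ is rationally almost periodic if for every $\varepsilon>0$ there is a periodic $y\colon\mathbb N_0\to\Omega$ with $|\{n<N: x(n)\ne y(n)\}|/N\le\varepsilon$ for all sufficiently large $N$. Gowers norms: for a finite abelian group $Z$, $\|f\|_{U^d(Z)}^{2^d}=\mathbb{E}_{(n_0,\dots,n_d)\in Z^{d+1}}\prod_{\omega\in\{0,1\}^d}\mathcal{C}^{|\omega|}f(n_0+\sum_i\omega_in_i)$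 with $\mathcal C$ complex conjugation and $|\omega|$ the number of ones in $\omega$; for $N\ge1$, $[N]=\{0,\dots,N-1\}$ and $\|f\|_{U^d[N]}=\|1_{[N]}f\|_{U^d(\mathbb Z/\tilde N\mathbb Z)}/\|1_{[N]}\|_{U^d(\mathbb Z/\tilde N\mathbb Z)}$ with $\tilde N$ the least prime $>2dN$. A bounded $a\colon\mathbb N_0\to\mathbb C$ is highly Gowers uniform if for every $d\ge1$ there is $c_d>0$ with $\|a\|_{U^d[N]}\ll N^{-c_d}$. *)

theory Defs
  imports
    "HOL-Algebra.Elementary_Groups"
    "HOL-Algebra.FiniteProduct"
    "HOL-Computational_Algebra.Primes"
    Complex_Main
begin

section \<open>Automatic sequences\<close>

text \<open>
  Words over \<open>\<Sigma>\<^sub>k = {0, \<dots>, k - 1}\<close> are the lists in \<^term>\<open>lists {..<k}\<close>. The expansion is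
  written with the most significant digit first, and the expansion of \<open>0\<close> is the empty word.
\<close>

function base_expansion :: "nat \<Rightarrow> nat \<Rightarrow> nat list" where
  "base_expansion k n =
     (if k < 2 \<or> n = 0 then [] else base_expansion k (n div k) @ [n mod k])"
  by pat_completeness auto
termination
  by (relation "measure snd") auto

declare base_expansion.simps [simp del]

text \<open>
  The output alphabet \<open>\<Omega>\<close> is the type \<^typ>\<open>'o\<close>. The values of the transition and output functions
  matter only on \<^term>\<open>aut_states A\<close> and, for the letters, on \<^term>\<open>{..<k}\<close>.
\<close>

record ('s, 'o) automaton =
  aut_states :: "'s set"
  aut_init :: 's
  aut_trans :: "'s \<Rightarrow> nat \<Rightarrow> 's"
  aut_out :: "'s \<Rightarrow> 'o"

definition k_automaton :: "nat \<Rightarrow> ('s, 'o) automaton \<Rightarrow> bool" where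
  "k_automaton k A \<longleftrightarrow>
     k \<ge> 2 \<and> finite (aut_states A) \<and> aut_init A \<in> aut_states A \<and>
     (\<forall>s\<in>aut_states A. \<forall>j<k. aut_trans A s j \<in> aut_states A)"

definition aut_run :: "('s, 'o) automaton \<Rightarrow> 's \<Rightarrow> nat list \<Rightarrow> 's" where
  "aut_run A s w = foldl (aut_trans A) s w"

lemma aut_run_append: "aut_run A s (u @ v) = aut_run A (aut_run A s u) v"
  by (simp add: aut_run_def)

definition produced_seq :: "nat \<Rightarrow> ('s, 'o) automaton \<Rightarrow> nat \<Rightarrow> 'o" where
  "produced_seq k A n = aut_out A (aut_run A (aut_init A) (base_expansion k n))"

definition prolongable :: "('s, 'o) automaton \<Rightarrow> bool" where
  "prolongable A \<longleftrightarrow> aut_trans A (aut_init A) 0 = aut_init A"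

definition strongly_connected :: "nat \<Rightarrow> ('s, 'o) automaton \<Rightarrow> bool" where
  "strongly_connected k A \<longleftrightarrow>
     (\<forall>s\<in>aut_states A. \<forall>s'\<in>aut_states A. \<exists>w\<in>lists {..<k}. aut_run A s w = s')"


section \<open>Rationally almost periodic sequences\<close>

definition periodic_seq :: "(nat \<Rightarrow> 'o) \<Rightarrow> bool" where
  "periodic_seq y \<longleftrightarrow> (\<exists>m\<ge>1. \<forall>n. y (n + m) = y n)"

definition rationally_almost_periodic :: "(nat \<Rightarrow> 'o) \<Rightarrow> bool" where
  "rationally_almost_periodic x \<longleftrightarrow>
     (\<forall>\<epsilon>>0. \<exists>y. periodic_seq y \<and>
        (\<forall>\<^sub>F N in sequentially. real (card {n. n < N \<and> x n \<noteq> y n}) / real N \<le> \<epsilon>))"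


section \<open>Gowers norms\<close>

text \<open>
  For a finite commutative group \<open>Z\<close> (written multiplicatively), a vector
  \<open>\<omega> \<in> {0,1}\<^sup>d\<close> is represented by its support, a subset of \<^term>\<open>{1..d}\<close>, so that
  \<open>|\<omega>|\<close> is the cardinality and \<open>n\<^sub>0 + \<Sum>\<^sub>i \<omega>\<^sub>i n\<^sub>i\<close> is a product over the support.
\<close>

definition gowers_average :: "nat \<Rightarrow> ('g, 'm) monoid_scheme \<Rightarrow> ('g \<Rightarrow> complex) \<Rightarrow> complex" where
  "gowers_average d Z f =
     (\<Sum>v\<in>{0..d} \<rightarrow>\<^sub>E carrier Z.
        \<Prod>\<omega>\<in>Pow {1..d}. (cnj ^^ card \<omega>) (f (v 0 \<otimes>\<^bsub>Z\<^esub> finprod Z v \<omega>)))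
     / of_nat (card (carrier Z) ^ (d + 1))"

text \<open>
  For \<open>d \<ge> 1\<close> the average is a nonnegative real number, hence equal to its real part; the norm
  is its nonnegative root of order \<open>2\<^sup>d\<close>.
\<close>

definition gowers_norm :: "nat \<Rightarrow> ('g, 'm) monoid_scheme \<Rightarrow> ('g \<Rightarrow> complex) \<Rightarrow> real" where
  "gowers_norm d Z f = root (2 ^ d) (Re (gowers_average d Z f))"

definition gowers_modulus :: "nat \<Rightarrow> nat \<Rightarrow> nat" where
  "gowers_modulus d N = (LEAST p. prime p \<and> p > 2 * d * N)"

text \<open>
  The carrier of \<^term>\<open>integer_mod_group m\<close> is \<open>{0, \<dots>, m - 1}\<close>, so \<open>1\<^bsub>[N]\<^esub> f\<close> is transported to
  \<open>\<int>/m\<int>\<close> along these representatives.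
\<close>

definition restrict_to_initial :: "nat \<Rightarrow> (nat \<Rightarrow> complex) \<Rightarrow> int \<Rightarrow> complex" where
  "restrict_to_initial N f x = (if 0 \<le> x \<and> x < int N then f (nat x) else 0)"

definition gowers_norm_initial :: "nat \<Rightarrow> nat \<Rightarrow> (nat \<Rightarrow> complex) \<Rightarrow> real" where
  "gowers_norm_initial d N f =
     gowers_norm d (integer_mod_group (gowers_modulus d N)) (restrict_to_initial N f) /
     gowers_norm d (integer_mod_group (gowers_modulus d N)) (restrict_to_initial N (\<lambda>_. 1))"

definition highly_gowers_uniform :: "(nat \<Rightarrow> complex) \<Rightarrow> bool" where
  "highly_gowers_uniform a \<longleftrightarrow>
     (\<exists>B. \<forall>n. cmod (a n) \<le> B) \<and>
     (\<forall>d\<ge>1. \<exists>c>0. \<exists>C. \<forall>N\<ge>1. gowers_norm_initial d N a \<le> C * real N powr (- c))"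

end

theory Submission
  imports Defs
begin

text \<open>
  Passing to a power of the base, some digit \<open>z\<close> acts as an idempotent \<open>e\<close> of minimal rank absorbing
  the digit \<open>0\<close>, and the elements \<open>e x e\<close>, for \<open>x\<close> an action of a word, form a finite group \<open>G\<close>.
  For each \<open>d\<close>, words read along the vertices of a cube \<open>x\<^sub>0 + \<Sum>\<^bsub>i\<in>\<omega>\<^esub> x\<^sub>i\<close> give a group \<open>K\<^sub>d\<close> of
  cubes of elements of \<open>G\<close>; let \<open>N\<close> be the normal subgroup of those \<open>h\<close> that may be put on any
  single vertex, for every \<open>d\<close>, with \<open>e\<close> on all others. The structured part averages
  the output over cosets of \<open>N\<close>.

  Modulo \<open>N\<close> the group element of \<open>u + 1\<close> is a constant times that of \<open>u\<close>, so it depends only on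
  \<open>u\<close> modulo a fixed integer. Once the digit \<open>z\<close> occurs among the last digits of \<open>n\<close>, everything before
  it matters only through this element, whence almost periodicity.

  For uniformity, read the digits of a cube in blocks and keep track of carries. By definition
  of \<open>N\<close>, from every carry some block contents differ only by the element of \<open>N\<close> at one vertex; as
  the uniform part has mean zero on cosets of \<open>N\<close>, their contributions cancel, and each
  block contracts the Gowers average by a constant factor.
\<close>

section \<open>Digit actions\<close>

text \<open>The number \<open>t\<close> of digits is prescribed, so leading zeros count. The lowest
  digit is the leftmost factor: for maps composed from right to left, the most significant digit
  acts first, as in an automaton.\<close>

fun digit_act :: "nat \<Rightarrow> (nat \<Rightarrow> 'm::monoid_mult) \<Rightarrow> nat \<Rightarrow> nat \<Rightarrow> 'm" where
  "digit_act b T 0 n = 1"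
| "digit_act b T (Suc t) n = T (n mod b) * digit_act b T t (n div b)"

lemma digit_act_add:
  "digit_act b T (s + t) n = digit_act b T s n * digit_act b T t (n div b ^ s)"
  by (induction s arbitrary: n) (auto simp: mult.assoc div_mult2_eq)

lemma digit_act_mod: "digit_act b T t (n mod b ^ t) = digit_act b T t n"
proof (induction t arbitrary: n)
  case (Suc t)
  have "n mod b ^ Suc t mod b = n mod b"
    by (simp add: mod_mod_cancel)
  moreover have "n mod b ^ Suc t div b = (n div b) mod b ^ t"
    by (cases "b = 0") (auto simp: mod_mult2_eq)
  ultimately show ?case
    using Suc[of "n div b"] by simp
qed simp

text \<open>Here \<open>y\<close> may exceed \<open>b ^ s\<close>; its overflow is added to
  \<open>x\<close>. All carry bookkeeping below rests on this identity.\<close>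

lemma digit_act_append:
  assumes "b > 0"
  shows "digit_act b T (s + t) (x * b ^ s + y) = digit_act b T s y * digit_act b T t (x + y div b ^ s)"
proof -
  have "digit_act b T s (x * b ^ s + y) = digit_act b T s y"
    by (metis digit_act_mod mod_mult_self3)
  thus ?thesis using assms by (simp add: digit_act_add)
qed

lemma digit_act_zero: "digit_act b T t 0 = T 0 ^ t"
  by (induction t) auto

lemma digit_act_base_power:
  "digit_act (b ^ m) (digit_act b T m) t n = digit_act b T (m * t) n"
  by (induction t arbitrary: n) (auto simp: digit_act_add digit_act_mod)

text \<open>\<open>exponent\<close> makes the elements \<open>e x e\<close> invertible with respect
  to \<open>e\<close>. The form \<open>Suc (Suc E)\<close> leaves the positive power
  \<open>Suc E\<close> as inverse, so that the \<open>1\<close> of the monoid, which need not have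
  the form \<open>e x e\<close>, never enters.\<close>

locale idempotent_digit =
  fixes W z E :: nat and T :: "nat \<Rightarrow> 'm::monoid_mult"
  assumes W: "W \<ge> 2" and z: "z < W"
    and idem: "T z * T z = T z"
    and zero_left: "T 0 * T z = T z" and zero_right: "T z * T 0 = T z"
    and exponent: "\<And>t n. (T z * digit_act W T t n * T z) ^ Suc (Suc E) = T z"
    and fin: "finite {digit_act W T t n | t n. True}"
begin

abbreviation e where "e \<equiv> T z"
abbreviation act where "act \<equiv> digit_act W T"

text \<open>
  Since \<open>T 0 * e = e\<close>, leading zeros do not matter, and \<open>n\<close> is a convenient number of digits that
  certainly suffices to write \<open>n\<close>.
\<close>

definition rr :: "nat \<Rightarrow> 'm" where "rr n = act n n * e"
definition lam :: "nat \<Rightarrow> 'm" where "lam n = e * act n n * e"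

lemma W0: "W > 0" using W by auto

lemma less_W_power: "n < W ^ n"
  using W by (metis Suc_1 Suc_le_lessD dual_order.strict_trans2 less_exp linorder_not_le power_mono zero_le)

lemma T0_power_e: "T 0 ^ t * e = e"
  by (induction t) (auto simp: mult.assoc zero_left power_Suc2 simp del: power_Suc)

lemma e_T0_power: "e * T 0 ^ t = e"
  by (induction t) (auto simp: mult.assoc[symmetric] zero_right)

lemma act_e_le:
  assumes "n < W ^ s" "s \<le> t"
  shows "act t n * e = act s n * e"
proof -
  obtain u where t: "t = s + u" using assms le_Suc_ex by blast
  show ?thesis unfolding t digit_act_add using assms
    by (simp add: digit_act_zero mult.assoc T0_power_e)
qed

lemma act_e_eq:
  assumes "n < W ^ s" "n < W ^ t"
  shows "act t n * e = act s n * e"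
  by (metis act_e_le assms nle_le)

lemma rr_eq: "n < W ^ t \<Longrightarrow> rr n = act t n * e"
  unfolding rr_def by (intro act_e_eq less_W_power)

lemma lam_rr: "lam n = e * rr n"
  by (simp add: lam_def rr_def mult.assoc)

lemma lam_eq: "n < W ^ t \<Longrightarrow> lam n = e * act t n * e"
  by (simp add: lam_rr rr_eq mult.assoc)

lemma rr_append: "rr (x * W ^ s + y) = act s y * rr (x + y div W ^ s)"
proof -
  define t where "t = x * W ^ s + y + (x + y div W ^ s)"
  have le: "W ^ n \<le> W ^ m" if "n \<le> m" for n m using W that by (intro power_increasing) auto
  have 1: "x * W ^ s + y < W ^ (s + t)"
    by (rule less_le_trans[OF less_W_power le]) (auto simp: t_def)
  have 2: "x + y div W ^ s < W ^ t"
    by (rule less_le_trans[OF less_W_power le]) (auto simp: t_def)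
  show ?thesis
    unfolding rr_eq[OF 1] rr_eq[OF 2] by (simp add: digit_act_append W0 mult.assoc)
qed

lemma act_z: "act (Suc t) (z * W ^ t + y) = act t y * e" if "y < W ^ t"
  using digit_act_append[of W T t 1 z y] that W z by simp

text \<open>The digit \<open>z\<close> contributes \<open>e\<close> on one side and
  \<open>rr\<close> contributes it on the other, so the digits above position \<open>t\<close> enter
  only through \<open>lam x\<close>. As \<open>y < W ^ t\<close>, no carry reaches them.\<close>

lemma rr_z: "rr (x * W ^ Suc t + z * W ^ t + y) = act t y * lam x" if "y < W ^ t"
proof -
  have "z * W ^ t + y < W ^ Suc t"
  proof -
    have "z * W ^ t + y < Suc z * W ^ t" using that by simp
    also have "\<dots> \<le> W * W ^ t" using z by (intro mult_right_mono) auto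
    finally show ?thesis by simp
  qed
  thus ?thesis
    using rr_append[of x "Suc t" "z * W ^ t + y"] act_z[OF that]
    by (simp add: lam_rr mult.assoc[symmetric] add.assoc del: digit_act.simps power_Suc)
qed

lemma e_lam: "e * lam n = lam n" and lam_e: "lam n * e = lam n"
  by (simp_all add: lam_def idem mult.assoc[symmetric]) (simp add: mult.assoc idem)

text \<open>Inserting \<open>z\<close> between two expansions multiplies their elements, the low
  digits giving the left factor. This is why \<open>range lam\<close> is closed under
  products.\<close>

lemma lam_z: "lam (x * W ^ Suc t + z * W ^ t + y) = lam y * lam x" if "y < W ^ t"
  using rr_z[OF that, of x] by (simp add: lam_rr rr_eq[OF that] mult.assoc)
    (metis e_lam lam_rr)

lemma lam_0: "lam 0 = e"
  by (simp add: lam_def idem)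

lemma lam_shift: "lam (x * W ^ s) = lam x"
  using rr_append[of x s 0] by (simp add: lam_rr digit_act_zero mult.assoc[symmetric] e_T0_power)

section \<open>The group \<open>G\<close> with identity \<open>e\<close>\<close>

definition G :: "'m set" where "G = range lam"

lemma lam_G [simp]: "lam n \<in> G" by (simp add: G_def)

lemma e_act_e_G: "e * act t n * e \<in> G"
proof -
  have "n mod W ^ t < W ^ t" using W by simp
  from lam_eq[OF this] show ?thesis by (metis digit_act_mod lam_G)
qed

lemma e_G [simp]: "e \<in> G" using lam_0 lam_G by metis

lemma G_mult [simp]: "g \<in> G \<Longrightarrow> h \<in> G \<Longrightarrow> g * h \<in> G"
proof -
  assume "g \<in> G" "h \<in> G"
  then obtain m n where "g = lam m" "h = lam n" by (auto simp: G_def)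
  then show ?thesis using lam_z[OF less_W_power, of n m] by (metis lam_G lam_z less_W_power)
qed

lemma e_mult [simp]: "g \<in> G \<Longrightarrow> e * g = g" and mult_e [simp]: "g \<in> G \<Longrightarrow> g * e = g"
  by (auto simp: G_def e_lam lam_e)

lemma G_power [simp]: "g \<in> G \<Longrightarrow> g ^ Suc n \<in> G"
  by (induction n) auto

text \<open>Being a fixed positive power, the inverse preserves whatever is closed under products;
  \<open>K_ginv\<close> and \<open>N_ginv\<close> rest on this.\<close>

definition ginv :: "'m \<Rightarrow> 'm" where "ginv g = g ^ Suc E"

lemma ginv_G [simp]: "g \<in> G \<Longrightarrow> ginv g \<in> G"
  by (simp add: ginv_def del: power_Suc)

lemma G_exponent: "g \<in> G \<Longrightarrow> g ^ Suc (Suc E) = e"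
  unfolding G_def lam_def using exponent by blast

lemma ginv_left [simp]: "g \<in> G \<Longrightarrow> ginv g * g = e"
  and ginv_right [simp]: "g \<in> G \<Longrightarrow> g * ginv g = e"
  using G_exponent[of g] by (simp_all add: ginv_def power_commutes mult.assoc)

lemma ginv_left_assoc [simp]: "g \<in> G \<Longrightarrow> h \<in> G \<Longrightarrow> ginv g * (g * h) = h"
  and ginv_right_assoc [simp]: "g \<in> G \<Longrightarrow> h \<in> G \<Longrightarrow> g * (ginv g * h) = h"
  by (simp_all add: mult.assoc[symmetric])

lemma ginv_unique: "g \<in> G \<Longrightarrow> h \<in> G \<Longrightarrow> h * g = e \<Longrightarrow> h = ginv g"
  by (metis ginv_G ginv_right mult.assoc mult_e e_mult)

lemma ginv_ginv [simp]: "g \<in> G \<Longrightarrow> ginv (ginv g) = g"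
  by (rule ginv_unique[symmetric]) simp_all

lemma ginv_e [simp]: "ginv e = e"
  by (rule ginv_unique[symmetric]) (simp_all add: idem)

section \<open>Cubes of group elements\<close>

definition vert :: "(nat \<Rightarrow> nat) \<Rightarrow> nat set \<Rightarrow> nat" where
  "vert x I = x 0 + (\<Sum>i\<in>I. x i)"

text \<open>Values at sets not contained in \<open>{1..d}\<close> are left free, which
  \<open>K_cong\<close> exploits.\<close>

definition K :: "nat \<Rightarrow> (nat set \<Rightarrow> 'm) set" where
  "K d = {\<kappa>. \<exists>x. \<forall>I\<subseteq>{1..d}. \<kappa> I = lam (vert x I)}"

lemma K_cong: "(\<And>I. I \<subseteq> {1..d} \<Longrightarrow> \<kappa> I = \<kappa>' I) \<Longrightarrow> \<kappa> \<in> K d \<longleftrightarrow> \<kappa>' \<in> K d"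
  unfolding K_def by auto

lemma K_G: "\<kappa> \<in> K d \<Longrightarrow> I \<subseteq> {1..d} \<Longrightarrow> \<kappa> I \<in> G"
  unfolding K_def by auto

lemma vert_mono: "I \<subseteq> J \<Longrightarrow> finite J \<Longrightarrow> vert x I \<le> vert x J"
  unfolding vert_def by (simp add: sum_mono2)

text \<open>Concatenate the two cubes digitwise, \<open>y\<close> above \<open>x\<close>. The
  separating digit \<open>z\<close> is put into coordinate \<open>0\<close> only, so every vertex
  contains it exactly once, and \<open>t\<close> is large enough for no vertex of \<open>x\<close>
  to overflow.\<close>

lemma K_mult:
  assumes "\<kappa> \<in> K d" "\<kappa>' \<in> K d"
  shows "(\<lambda>I. \<kappa> I * \<kappa>' I) \<in> K d"
proof -
  obtain x y where x: "\<And>I. I \<subseteq> {1..d} \<Longrightarrow> \<kappa> I = lam (vert x I)"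
    and y: "\<And>I. I \<subseteq> {1..d} \<Longrightarrow> \<kappa>' I = lam (vert y I)"
    using assms unfolding K_def by blast
  define t where "t = vert x {1..d}"
  define w where "w i = y i * W ^ Suc t + (if i = 0 then z * W ^ t else 0) + x i" for i
  have "\<kappa> I * \<kappa>' I = lam (vert w I)" if I: "I \<subseteq> {1..d}" for I
  proof -
    have "vert x I < W ^ t"
      using vert_mono[OF I, of x] less_W_power[of t] by (simp add: t_def)
    moreover have "(\<Sum>i\<in>I. w i) = (\<Sum>i\<in>I. y i) * W ^ Suc t + (\<Sum>i\<in>I. x i)"
    proof -
      have "(\<Sum>i\<in>I. w i) = (\<Sum>i\<in>I. y i * W ^ Suc t + x i)"
        using I by (intro sum.cong) (auto simp: w_def)
      thus ?thesis by (simp add: sum.distrib sum_distrib_right)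
    qed
    hence "vert w I = vert y I * W ^ Suc t + z * W ^ t + vert x I"
      by (simp add: vert_def w_def algebra_simps)
    ultimately show ?thesis using lam_z x y I by simp
  qed
  thus ?thesis unfolding K_def by blast
qed

lemma K_const: "g \<in> G \<Longrightarrow> (\<lambda>_. g) \<in> K d"
proof -
  assume "g \<in> G"
  then obtain n where n: "g = lam n" by (auto simp: G_def)
  have "vert (\<lambda>i. if i = 0 then n else 0) I = n" if "I \<subseteq> {1..d}" for I
  proof -
    have "(\<Sum>i\<in>I. if i = 0 then n else 0) = 0" using that by (intro sum.neutral) auto
    thus ?thesis by (simp add: vert_def)
  qed
  thus ?thesis unfolding K_def n by (intro CollectI exI[of _ "\<lambda>i. if i = 0 then n else 0"]) simp
qed

lemma K_power: "\<kappa> \<in> K d \<Longrightarrow> (\<lambda>I. \<kappa> I ^ Suc n) \<in> K d"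
  by (induction n) (auto dest: K_mult)

lemma K_ginv: "\<kappa> \<in> K d \<Longrightarrow> (\<lambda>I. ginv (\<kappa> I)) \<in> K d"
  by (simp add: ginv_def K_power del: power_Suc)

definition single :: "nat set \<Rightarrow> 'm \<Rightarrow> nat set \<Rightarrow> 'm" where
  "single \<omega> h I = (if I = \<omega> then h else e)"

text \<open>Divide out the vertices other than \<open>\<omega>\<close> one at a time.\<close>

lemma K_isolate:
  assumes \<kappa>: "\<kappa> \<in> K d" and \<omega>: "\<omega> \<subseteq> {1..d}"
    and others: "\<And>I. I \<subseteq> {1..d} \<Longrightarrow> I \<noteq> \<omega> \<Longrightarrow> single I (\<kappa> I) \<in> K d"
  shows "single \<omega> (\<kappa> \<omega>) \<in> K d"
proof -
  have remove: "(\<lambda>I. if I \<in> X then e else \<kappa> I) \<in> K d" if "finite X" "X \<subseteq> Pow {1..d} - {\<omega>}" for X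
    using that
  proof (induction X rule: finite_induct)
    case empty
    thus ?case using \<kappa> by simp
  next
    case (insert J X)
    have "(\<lambda>I. (if I \<in> X then e else \<kappa> I) * ginv (single J (\<kappa> J) I)) \<in> K d"
      using insert by (intro K_mult K_ginv others) auto
    moreover have "(if I \<in> X then e else \<kappa> I) * ginv (single J (\<kappa> J) I)
        = (if I \<in> insert J X then e else \<kappa> I)" if "I \<subseteq> {1..d}" for I
      using insert K_G[OF \<kappa> that] by (auto simp: single_def idem)
    ultimately show ?case
      by (subst K_cong[where \<kappa>' = "\<lambda>I. (if I \<in> X then e else \<kappa> I) * ginv (single J (\<kappa> J) I)"]) auto
  qed
  have "(\<lambda>I. if I \<in> Pow {1..d} - {\<omega>} then e else \<kappa> I) \<in> K d"
    by (rule remove) auto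
  moreover have "single \<omega> (\<kappa> \<omega>) I = (if I \<in> Pow {1..d} - {\<omega>} then e else \<kappa> I)"
    if "I \<subseteq> {1..d}" for I
    using that by (auto simp: single_def)
  ultimately show ?thesis
    by (subst K_cong[where \<kappa>' = "\<lambda>I. if I \<in> Pow {1..d} - {\<omega>} then e else \<kappa> I"])
qed

definition NN :: "nat \<Rightarrow> 'm set" where
  "NN d = {h \<in> G. \<forall>\<omega>\<subseteq>{1..d}. single \<omega> h \<in> K d}"

definition N :: "'m set" where "N = (\<Inter>d. NN d)"

section \<open>The normal subgroup \<open>N\<close>\<close>

lemma N_G: "h \<in> N \<Longrightarrow> h \<in> G" by (auto simp: N_def NN_def)

lemma NN_e: "e \<in> NN d"
proof -
  have "single \<omega> e \<in> K d" for \<omega>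
    using K_const[OF e_G, of d] by (simp add: single_def[abs_def])
  thus ?thesis by (simp add: NN_def)
qed

lemma NN_mult: "g \<in> NN d \<Longrightarrow> h \<in> NN d \<Longrightarrow> g * h \<in> NN d"
proof -
  assume a: "g \<in> NN d" "h \<in> NN d"
  have "single \<omega> (g * h) \<in> K d" if "\<omega> \<subseteq> {1..d}" for \<omega>
  proof -
    have "(\<lambda>I. single \<omega> g I * single \<omega> h I) \<in> K d" using a that by (intro K_mult) (auto simp: NN_def)
    moreover have "(\<lambda>I. single \<omega> g I * single \<omega> h I) = single \<omega> (g * h)"
      by (auto simp: single_def idem fun_eq_iff)
    ultimately show ?thesis by simp
  qed
  thus ?thesis using a by (auto simp: NN_def)
qed

text \<open>Conjugation by the constant cube \<open>g\<close> leaves the entries \<open>e\<close>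
  unchanged.\<close>

lemma NN_conj: "g \<in> G \<Longrightarrow> h \<in> NN d \<Longrightarrow> g * h * ginv g \<in> NN d"
proof -
  assume a: "g \<in> G" "h \<in> NN d"
  have "single \<omega> (g * h * ginv g) \<in> K d" if "\<omega> \<subseteq> {1..d}" for \<omega>
  proof -
    have "(\<lambda>I. (g * single \<omega> h I) * ginv g) \<in> K d" using a that
      by (intro K_mult K_const) (auto simp: NN_def)
    moreover have "(\<lambda>I. (g * single \<omega> h I) * ginv g) = single \<omega> (g * h * ginv g)"
      using a by (auto simp: single_def fun_eq_iff)
    ultimately show ?thesis by simp
  qed
  thus ?thesis using a by (auto simp: NN_def)
qed

lemma N_e: "e \<in> N" by (simp add: N_def NN_e)
lemma N_mult: "g \<in> N \<Longrightarrow> h \<in> N \<Longrightarrow> g * h \<in> N" by (auto simp: N_def NN_mult)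
lemma N_conj: "g \<in> G \<Longrightarrow> h \<in> N \<Longrightarrow> g * h * ginv g \<in> N" by (auto simp: N_def NN_conj)
lemma N_conj': "g \<in> G \<Longrightarrow> h \<in> N \<Longrightarrow> ginv g * h * g \<in> N"
  using N_conj[of "ginv g" h] by simp
lemma N_power: "h \<in> N \<Longrightarrow> h ^ Suc n \<in> N"
  by (induction n) (auto simp: N_mult)
lemma N_ginv: "h \<in> N \<Longrightarrow> ginv h \<in> N"
  by (simp add: ginv_def N_power del: power_Suc)

lemma finite_N: "finite N"
proof (rule finite_subset)
  show "N \<subseteq> (\<lambda>x. e * x * e) ` {digit_act W T t n | t n. True}"
  proof
    fix h assume "h \<in> N"
    then obtain n where "h = lam n" using N_G unfolding G_def by blast
    hence "h = e * act n n * e" by (simp only: lam_def)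
    thus "h \<in> (\<lambda>x. e * x * e) ` {digit_act W T t n | t n. True}" by blast
  qed
qed (intro finite_imageI fin)

lemma sum_N_left: "k \<in> N \<Longrightarrow> (\<Sum>h\<in>N. f (k * h)) = (\<Sum>h\<in>N. f h)"
  by (rule sum.reindex_bij_witness[of _ "\<lambda>h. ginv k * h" "\<lambda>h. k * h"])
     (auto simp: N_mult N_ginv N_G)

text \<open>By normality, conjugation by \<open>g\<close> permutes \<open>N\<close>. This moves a
  factor from \<open>N\<close> past a group element inside a sum.\<close>

lemma sum_N_conj: "g \<in> G \<Longrightarrow> (\<Sum>h\<in>N. f (h * g)) = (\<Sum>h\<in>N. f (g * h))"
  by (rule sum.reindex_bij_witness[of _ "\<lambda>h. g * h * ginv g" "\<lambda>h. ginv g * h * g"])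
     (use N_conj N_conj' N_G in \<open>auto simp: mult.assoc\<close>)

section \<open>The quotient by N is cyclic\<close>

text \<open>
  Appending \<open>s\<close> digits \<open>q\<close> to \<open>u\<close> multiplies \<open>lam u\<close> by an element depending on \<open>u\<close> and \<open>q\<close>; \<open>diffq\<close>
  compares these elements for \<open>u\<close> and \<open>u'\<close>. It is trivial when \<open>q\<close> starts with the digit \<open>z\<close>, and the
  case of interest is the overflow \<open>q = W ^ s\<close>, where \<open>u\<close> becomes \<open>u + 1\<close>.
\<close>

definition diffq :: "nat \<Rightarrow> nat \<Rightarrow> nat \<Rightarrow> nat \<Rightarrow> 'm" where
  "diffq s u u' q = lam (u * W ^ s + q) * ginv (lam u) * ginv (lam (u' * W ^ s + q) * ginv (lam u'))"

text \<open>Adding \<open>u * W ^ s\<close> only moves the base point of the cube, and the factors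
  not involving \<open>q\<close> are constant cubes; products and inverses stay in
  \<open>K d\<close>.\<close>

lemma diffq_cube: "(\<lambda>I. diffq s u u' (vert x I)) \<in> K d"
proof -
  have "(\<lambda>I. lam (u * W ^ s + vert x I)) \<in> K d" for u
    unfolding K_def
  proof (intro CollectI exI allI impI)
    fix I assume "I \<subseteq> {1..d}"
    hence "vert (x(0 := u * W ^ s + x 0)) I = u * W ^ s + vert x I"
      by (auto simp: vert_def intro!: sum.cong)
    thus "lam (u * W ^ s + vert x I) = lam (vert (x(0 := u * W ^ s + x 0)) I)" by simp
  qed
  thus ?thesis unfolding diffq_def
    by (intro K_mult K_ginv K_const) auto
qed

lemma diffq_G [simp]: "diffq s u u' q \<in> G" by (simp add: diffq_def)

text \<open>With leading digit \<open>z\<close>, \<open>lam_z\<close> splits off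
  \<open>lam u\<close>, and what is left depends only on the lower digits of
  \<open>q\<close>.\<close>

lemma diffq_base:
  assumes "z * W ^ s \<le> q" "q < Suc z * W ^ s"
  shows "diffq (Suc s) u u' q = e"
proof -
  obtain y where y: "q = z * W ^ s + y" "y < W ^ s"
    using assms by (metis add_diff_cancel_left' add_less_cancel_left le_add_diff_inverse mult_Suc add.commute)
  have "lam (u * W ^ Suc s + q) * ginv (lam u) = lam y" for u
    using lam_z[OF y(2), of u] by (simp add: y(1) add.assoc mult.assoc)
  thus ?thesis unfolding diffq_def by simp
qed

text \<open>
  Induction on \<open>q\<close>, starting from the interval of those \<open>q\<close> with leading digit \<open>z\<close>. The cube with vertices
  \<open>q - |\<omega>| + |I \<inter> \<omega>|\<close> takes the value \<open>q\<close> exactly when \<open>I \<supseteq> \<omega>\<close>, so the vertices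
  \<open>I \<noteq> \<omega>\<close> can be removed either by the induction hypothesis or by descending induction on \<open>\<omega>\<close>.
\<close>

lemma diffq_NN:
  assumes d: "d \<le> W ^ s" and q: "z * W ^ s \<le> q"
  shows "diffq (Suc s) u u' q \<in> NN d"
  using q
proof (induction q rule: less_induct)
  case (less q)
  show ?case
  proof (cases "q < Suc z * W ^ s")
    case True
    thus ?thesis using less diffq_base NN_e by simp
  next
    case False
    have "single \<omega> (diffq (Suc s) u u' q) \<in> K d" if "\<omega> \<subseteq> {1..d}" for \<omega>
      using that
    proof (induction "card ({1..d} - \<omega>)" arbitrary: \<omega> rule: less_induct)
      case less2: less
      have c: "card \<omega> \<le> d" using less2(2) by (metis card_atLeastAtMost card_mono diff_Suc_1 finite_atLeastAtMost)
      have fin: "finite \<omega>" using less2(2) finite_subset by blast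
      define x where "x i = (if i = 0 then q - card \<omega> else if i \<in> \<omega> then 1 else 0)" for i
      have vx: "vert x I = q - card \<omega> + card (I \<inter> \<omega>)" if "I \<subseteq> {1..d}" for I
      proof -
        have "(\<Sum>i\<in>I. x i) = (\<Sum>i\<in>I. if i \<in> \<omega> then 1 else 0)"
          using that by (intro sum.cong) (auto simp: x_def)
        also have "\<dots> = card (I \<inter> \<omega>)"
          using that finite_subset by (subst sum.inter_restrict[symmetric]) auto
        finally show ?thesis by (simp add: vert_def x_def)
      qed
      \<comment> \<open>Beyond the base interval \<open>q\<close> is at least
        \<open>Suc z * W ^ s\<close>, and \<open>card \<omega> \<le> d \<le> W ^ s\<close>, so the
        cube does not drop below the range of the induction.\<close>
      have qc: "q - card \<omega> \<ge> z * W ^ s" "card \<omega> \<le> q"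
        using False c d by auto
      have "single \<omega> (diffq (Suc s) u u' (vert x \<omega>)) \<in> K d"
      proof (rule K_isolate[where \<kappa> = "\<lambda>I. diffq (Suc s) u u' (vert x I)", OF diffq_cube less2(2)])
        fix I assume I: "I \<subseteq> {1..d}" "I \<noteq> \<omega>"
        show "single I (diffq (Suc s) u u' (vert x I)) \<in> K d"
        proof (cases "\<omega> \<subseteq> I")
          case True
          hence "vert x I = q" using vx[OF I(1)] qc by (simp add: Int_absorb1)
          moreover have "card ({1..d} - I) < card ({1..d} - \<omega>)"
            using True I by (intro psubset_card_mono) auto
          ultimately show ?thesis using less2(1) I by simp
        next
          case F: False
          hence "card (I \<inter> \<omega>) < card \<omega>" using fin by (intro psubset_card_mono) auto
          hence "vert x I < q" "z * W ^ s \<le> vert x I" using vx[OF I(1)] qc by auto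
          hence "diffq (Suc s) u u' (vert x I) \<in> NN d" by (intro less.IH)
          thus ?thesis using I by (auto simp: NN_def)
        qed
      qed
      moreover have "vert x \<omega> = q" using vx[OF less2(2)] qc by simp
      ultimately show ?case by simp
    qed
    thus ?thesis by (simp add: NN_def)
  qed
qed

text \<open>Apply \<open>diffq_NN\<close> with \<open>u' = 0\<close> and the overflow
  \<open>q = W ^ Suc d\<close>. Since \<open>lam\<close> ignores trailing zeros, the number of
  appended digits may grow with \<open>d\<close> while the element stays the same, so it lies in
  every \<open>NN d\<close>.\<close>

lemma lam_Suc_mod_N: "lam (Suc u) * ginv (lam u) * ginv (lam 1) \<in> N"
proof -
  have "lam (Suc u) * ginv (lam u) * ginv (lam 1) \<in> NN d" for d
  proof -
    have "z * W ^ d \<le> W ^ Suc d" using z by simp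
    moreover have "d \<le> W ^ d" using less_W_power less_imp_le by blast
    ultimately have "diffq (Suc d) u 0 (W ^ Suc d) \<in> NN d" by (rule_tac diffq_NN)
    moreover have "lam (u * W ^ Suc d + W ^ Suc d) = lam (Suc u)"
      using lam_shift[of "Suc u" "Suc d"] by (simp add: add.commute)
    moreover have "lam (W ^ Suc d) = lam 1"
      using lam_shift[of 1 "Suc d"] by simp
    ultimately show ?thesis by (simp add: diffq_def lam_0)
  qed
  thus ?thesis by (simp add: N_def)
qed

lemma lam_mod_N: "\<exists>h\<in>N. lam (u + i) = h * lam 1 ^ i * lam u"
proof (induction i)
  case 0
  show ?case using N_e by (auto intro!: bexI[of _ e])
next
  case (Suc i)
  then obtain h where h: "h \<in> N" "lam (u + i) = h * lam 1 ^ i * lam u" by blast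
  define k where "k = lam (Suc (u + i)) * ginv (lam (u + i)) * ginv (lam 1)"
  have k: "k \<in> N" unfolding k_def by (rule lam_Suc_mod_N)
  define h' where "h' = k * (lam 1 * h * ginv (lam 1))"
  have "h' \<in> N" unfolding h'_def using k h by (intro N_mult N_conj) auto
  moreover have "lam (u + Suc i) = k * (lam 1 * lam (u + i))"
    by (simp add: k_def mult.assoc)
  moreover have "\<dots> = h' * (lam 1 * (lam 1 ^ i * lam u))"
  proof -
    \<comment> \<open>For \<open>i = 0\<close> the power is the \<open>1\<close> of the monoid,
      which need not lie in \<open>G\<close>; only the product is known to.\<close>
    have "lam 1 ^ i * lam u \<in> G" by (cases i) (auto simp del: power_Suc)
    thus ?thesis unfolding h'_def h(2) using k h by (simp add: mult.assoc N_G)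
  qed
  ultimately show ?case by (auto intro!: bexI[of _ h'] simp: mult.assoc)
qed

text \<open>The exponent of \<open>G\<close> kills the power of \<open>lam 1\<close> in
  \<open>lam_mod_N\<close>. Normality then puts the factor from \<open>N\<close> on the right, where
  coset averages absorb it.\<close>

lemma lam_periodic: "\<exists>h\<in>N. lam (u + Suc (Suc E) * i) = lam u * h"
proof -
  have "lam 1 ^ (Suc (Suc E) * i) * lam u = lam u"
  proof (induction i)
    case (Suc i)
    have "lam 1 ^ (Suc (Suc E) * Suc i) * lam u = lam 1 ^ Suc (Suc E) * (lam 1 ^ (Suc (Suc E) * i) * lam u)"
      unfolding mult_Suc_right power_add mult.assoc ..
    thus ?case using Suc G_exponent[of "lam 1"] by (simp del: power_Suc)
  qed simp
  then obtain h where h: "h \<in> N" "lam (u + Suc (Suc E) * i) = h * lam u"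
    using lam_mod_N[of u "Suc (Suc E) * i"] by (auto simp: mult.assoc)
  have "lam u * (ginv (lam u) * h * lam u) = h * lam u"
    using h N_G by (simp add: mult.assoc)
  thus ?thesis using h N_conj'[OF lam_G] by metis
qed

end

text \<open>Reindexing by a coordinatewise bijection \<open>\<phi>\<close> with inverse
  \<open>(\<alpha>, \<beta>)\<close>. It serves to split every coordinate into quotient and
  remainder, for natural numbers and for integers.\<close>

lemma sum_PiE_split:
  assumes "\<And>a b. a \<in> A \<Longrightarrow> b \<in> B \<Longrightarrow> \<phi> a b \<in> C \<and> \<alpha> (\<phi> a b) = a \<and> \<beta> (\<phi> a b) = b"
    and "\<And>c. c \<in> C \<Longrightarrow> \<alpha> c \<in> A \<and> \<beta> c \<in> B \<and> \<phi> (\<alpha> c) (\<beta> c) = c"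
  shows "(\<Sum>g\<in>S \<rightarrow>\<^sub>E C. f g) =
    (\<Sum>y\<in>S \<rightarrow>\<^sub>E B. \<Sum>x\<in>S \<rightarrow>\<^sub>E A. f (\<lambda>i\<in>S. \<phi> (x i) (y i)))"
proof -
  have "(\<Sum>g\<in>S \<rightarrow>\<^sub>E C. f g) =
      (\<Sum>(y, x)\<in>(S \<rightarrow>\<^sub>E B) \<times> (S \<rightarrow>\<^sub>E A). f (\<lambda>i\<in>S. \<phi> (x i) (y i)))"
  proof (rule sum.reindex_bij_witness[of _ "\<lambda>(y, x). \<lambda>i\<in>S. \<phi> (x i) (y i)"
          "\<lambda>g. (\<lambda>i\<in>S. \<beta> (g i), \<lambda>i\<in>S. \<alpha> (g i))"])
    fix g assume g: "g \<in> S \<rightarrow>\<^sub>E C"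
    have "(\<lambda>i\<in>S. \<phi> ((\<lambda>i\<in>S. \<alpha> (g i)) i) ((\<lambda>i\<in>S. \<beta> (g i)) i)) = g"
      using g assms(2) by (auto simp: PiE_iff extensional_def fun_eq_iff)
    thus "(case (\<lambda>i\<in>S. \<beta> (g i), \<lambda>i\<in>S. \<alpha> (g i)) of (y, x) \<Rightarrow> \<lambda>i\<in>S. \<phi> (x i) (y i)) = g"
      and "(case (\<lambda>i\<in>S. \<beta> (g i), \<lambda>i\<in>S. \<alpha> (g i)) of
        (y, x) \<Rightarrow> f (\<lambda>i\<in>S. \<phi> (x i) (y i))) = f g"
      by simp_all
    show "(\<lambda>i\<in>S. \<beta> (g i), \<lambda>i\<in>S. \<alpha> (g i)) \<in> (S \<rightarrow>\<^sub>E B) \<times> (S \<rightarrow>\<^sub>E A)"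
      using g assms(2) by (auto simp: PiE_iff)
  next
    fix p assume "p \<in> (S \<rightarrow>\<^sub>E B) \<times> (S \<rightarrow>\<^sub>E A)"
    then obtain y x where p: "p = (y, x)" "y \<in> S \<rightarrow>\<^sub>E B" "x \<in> S \<rightarrow>\<^sub>E A" by auto
    have "(\<lambda>i\<in>S. \<beta> ((\<lambda>i\<in>S. \<phi> (x i) (y i)) i)) = y" "(\<lambda>i\<in>S. \<alpha> ((\<lambda>i\<in>S. \<phi> (x i) (y i)) i)) = x"
      using p assms(1) by (auto simp: PiE_iff extensional_def fun_eq_iff)
    thus "(\<lambda>i\<in>S. \<beta> ((case p of (y, x) \<Rightarrow> \<lambda>i\<in>S. \<phi> (x i) (y i)) i),
        \<lambda>i\<in>S. \<alpha> ((case p of (y, x) \<Rightarrow> \<lambda>i\<in>S. \<phi> (x i) (y i)) i)) = p"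
      by (simp add: p)
    show "(case p of (y, x) \<Rightarrow> \<lambda>i\<in>S. \<phi> (x i) (y i)) \<in> S \<rightarrow>\<^sub>E C"
      using p assms(1) by (auto simp: PiE_iff)
  qed
  thus ?thesis by (simp add: sum.cartesian_product)
qed

section \<open>Averages over cosets of \<open>N\<close>\<close>

context idempotent_digit
begin

text \<open>The cosets are \<open>r N\<close> for arbitrary \<open>r\<close> in the monoid, because
  the values \<open>rr n\<close> need not lie in \<open>G\<close>.\<close>

definition coset_avg :: "('m \<Rightarrow> complex) \<Rightarrow> 'm \<Rightarrow> complex" where
  "coset_avg F r = (\<Sum>h\<in>N. F (r * h)) / of_nat (card N)"

lemma card_N: "card N > 0"
  using finite_N N_e card_gt_0_iff by blast

lemma coset_avg_N: "k \<in> N \<Longrightarrow> coset_avg F (r * k) = coset_avg F r"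
  using sum_N_left[of k "\<lambda>h. F (r * h)"] by (simp add: coset_avg_def mult.assoc)

text \<open>The average is constant on \<open>r N\<close>. This is the cancellation that drives the
  uniform part.\<close>

lemma sum_N_minus_avg: "(\<Sum>h\<in>N. F (r * h) - coset_avg F (r * h)) = 0"
proof -
  have "(\<Sum>h\<in>N. coset_avg F (r * h)) = (\<Sum>h\<in>N. coset_avg F r)"
    by (intro sum.cong) (auto simp: coset_avg_N)
  also have "\<dots> = (\<Sum>h\<in>N. F (r * h))"
    using card_N by (simp add: coset_avg_def)
  finally show ?thesis by (simp add: sum_subtractf)
qed

lemma coset_avg_bounded:
  assumes "\<And>x. cmod (F x) \<le> B"
  shows "cmod (coset_avg F r) \<le> B"
proof -
  have "cmod (\<Sum>h\<in>N. F (r * h)) \<le> (\<Sum>h\<in>N. B)"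
    by (rule sum_norm_le) (use assms in auto)
  thus ?thesis using card_N by (simp add: coset_avg_def norm_divide field_simps)
qed

section \<open>The structured part\<close>

definition has_z :: "nat \<Rightarrow> nat \<Rightarrow> bool" where
  "has_z j n \<longleftrightarrow> (\<exists>i<j. n div W ^ i mod W = z)"

definition no_z :: "nat \<Rightarrow> nat set" where
  "no_z j = {n. n < W ^ j \<and> \<not> has_z j n}"

lemma finite_no_z: "finite (no_z j)" by (simp add: no_z_def)

lemma has_z_Suc: "has_z (Suc j) n \<longleftrightarrow> n mod W = z \<or> has_z j (n div W)"
proof -
  have "n div W ^ Suc i = n div W div W ^ i" for i by (simp add: div_mult2_eq)
  thus ?thesis unfolding has_z_def by (auto simp: less_Suc_eq_0_disj simp del: power_Suc)
qed

text \<open>Peel off one digit at a time, each with \<open>W - 1\<close> admissible values.\<close>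

lemma card_no_z: "card (no_z j) \<le> (W - 1) ^ j"
proof (induction j)
  case 0
  have "no_z 0 = {0}" by (auto simp: no_z_def has_z_def)
  thus ?case by simp
next
  case (Suc j)
  have "no_z (Suc j) \<subseteq> (\<lambda>(q, r). q * W + r) ` (no_z j \<times> ({..<W} - {z}))"
  proof
    fix n assume n: "n \<in> no_z (Suc j)"
    hence "n div W \<in> no_z j" "n mod W \<in> {..<W} - {z}"
      using W by (auto simp: no_z_def has_z_Suc less_mult_imp_div_less mult.commute)
    thus "n \<in> (\<lambda>(q, r). q * W + r) ` (no_z j \<times> ({..<W} - {z}))"
      by (intro image_eqI[of _ _ "(n div W, n mod W)"]) auto
  qed
  hence "card (no_z (Suc j)) \<le> card (no_z j \<times> ({..<W} - {z}))"
    by (intro surj_card_le) (auto simp: finite_no_z)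
  also have "\<dots> = card (no_z j) * (W - 1)" using z by (simp add: card_cartesian_product)
  finally show ?case using Suc by (simp add: mult.commute mult_le_mono2 order_trans)
qed

lemma has_z_mod: "has_z j (n mod W ^ j) = has_z j n"
proof -
  have "n mod W ^ j div W ^ i mod W = n div W ^ i mod W" if "i < j" for i
  proof -
    have "W ^ j = W ^ i * W ^ (j - i)" using that by (simp flip: power_add)
    hence "n mod W ^ j div W ^ i = n div W ^ i mod W ^ (j - i)"
      using W by (simp add: mod_mult2_eq)
    moreover have "W dvd W ^ (j - i)" using that by simp
    ultimately show ?thesis by (simp add: mod_mod_cancel)
  qed
  thus ?thesis by (auto simp: has_z_def)
qed

text \<open>Split off the lowest \<open>j\<close> digits: they form an element of
  \<open>no_z j\<close>, and the quotient takes at most \<open>M div W ^ j + 1\<close>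
  values.\<close>

lemma card_not_has_z: "card {n. n < M \<and> \<not> has_z j n} \<le> (M div W ^ j + 1) * (W - 1) ^ j"
proof -
  have "{n. n < M \<and> \<not> has_z j n} \<subseteq> (\<lambda>(q, r). q * W ^ j + r) ` ({..M div W ^ j} \<times> no_z j)"
  proof
    fix n assume n: "n \<in> {n. n < M \<and> \<not> has_z j n}"
    hence "n mod W ^ j \<in> no_z j" "n div W ^ j \<le> M div W ^ j"
      using W by (auto simp: no_z_def has_z_mod intro: div_le_mono)
    thus "n \<in> (\<lambda>(q, r). q * W ^ j + r) ` ({..M div W ^ j} \<times> no_z j)"
      by (intro image_eqI[of _ _ "(n div W ^ j, n mod W ^ j)"]) (auto simp: div_mult_mod_eq)
  qed
  hence "card {n. n < M \<and> \<not> has_z j n} \<le> card ({..M div W ^ j} \<times> no_z j)"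
    by (intro surj_card_le) (auto simp: finite_no_z)
  also have "\<dots> \<le> (M div W ^ j + 1) * (W - 1) ^ j"
    using card_no_z[of j] by (simp add: card_cartesian_product add_mono)
  finally show ?thesis .
qed

text \<open>Adding \<open>W ^ j * Suc (Suc E)\<close> leaves the digits up to the occurrence of
  \<open>z\<close> alone and increases the prefix \<open>x\<close> by a multiple of
  \<open>Suc (Suc E)\<close>; by \<open>lam_periodic\<close>, \<open>lam x\<close> changes only by a
  factor in \<open>N\<close>.\<close>

lemma coset_avg_rr_periodic:
  assumes "has_z j n"
  shows "coset_avg F (rr (n + W ^ j * Suc (Suc E))) = coset_avg F (rr n)"
proof -
  obtain i where i: "i < j" "n div W ^ i mod W = z" using assms by (auto simp: has_z_def)
  define x where "x = n div W ^ Suc i"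
  define y where "y = n mod W ^ i"
  define l where "l = W ^ (j - Suc i)"
  have y: "y < W ^ i" using W by (simp add: y_def)
  have "n = (n div W ^ i) * W ^ i + y" unfolding y_def by (rule div_mult_mod_eq[symmetric])
  also have "n div W ^ i = x * W + z"
    using i(2) by (metis div_mult2_eq mod_div_decomp power_Suc2 x_def)
  finally have n: "n = x * W ^ Suc i + z * W ^ i + y" by (simp add: algebra_simps)
  have "W ^ j = l * W ^ Suc i" using i by (simp add: l_def flip: power_add power_Suc)
  hence n': "n + W ^ j * Suc (Suc E) = (x + Suc (Suc E) * l) * W ^ Suc i + z * W ^ i + y"
    by (subst n) (simp add: algebra_simps)
  obtain h where h: "h \<in> N" "lam (x + Suc (Suc E) * l) = lam x * h"
    using lam_periodic by blast
  have "rr (n + W ^ j * Suc (Suc E)) = rr n * h"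
    unfolding n' rr_z[OF y] h(2) by (subst n) (simp add: rr_z[OF y] mult.assoc del: power_Suc)
  thus ?thesis using h coset_avg_N by simp
qed

lemma rationally_almost_periodic_coset_avg:
  "rationally_almost_periodic (\<lambda>n. coset_avg F (rr n))"
  unfolding rationally_almost_periodic_def
proof (intro allI impI)
  fix \<epsilon> :: real assume \<epsilon>: "\<epsilon> > 0"
  define \<rho> where "\<rho> = real (W - 1) / real W"
  have \<rho>: "0 \<le> \<rho>" "\<rho> < 1" using W by (auto simp: \<rho>_def)
  then obtain j where j: "\<rho> ^ j < \<epsilon> / 2" using real_arch_pow_inv[of "\<epsilon> / 2" \<rho>] \<epsilon> by auto
  \<comment> \<open>The default \<open>0\<close> where \<open>z\<close> is missing keeps
    \<open>y\<close> exactly periodic, since \<open>has_z j\<close> depends only on \<open>n\<close>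
    modulo \<open>W ^ j\<close>.\<close>
  define y where "y n = (if has_z j n then coset_avg F (rr n) else 0)" for n
  define P where "P = W ^ j * Suc (Suc E)"
  have "has_z j (n + P) = has_z j n" for n
    using has_z_mod[of j n] has_z_mod[of j "n + P"] by (simp add: P_def del: mult_Suc_right)
  hence "y (n + P) = y n" for n
    using coset_avg_rr_periodic[of j n F] by (simp add: y_def P_def)
  moreover have "P > 0" unfolding P_def using W by (intro mult_pos_pos) auto
  hence "P \<ge> 1" by simp
  ultimately have "periodic_seq y" unfolding periodic_seq_def by blast
  moreover have "\<forall>\<^sub>F M in sequentially.
      real (card {n. n < M \<and> coset_avg F (rr n) \<noteq> y n}) / real M \<le> \<epsilon>"
  proof -
    \<comment> \<open>Large enough for the last incomplete block, which costs at most
      \<open>(W - 1) ^ j\<close>, to take up at most \<open>M * (\<epsilon> / 2)\<close>.\<close>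
    obtain M0 where M0: "real M0 \<ge> 2 * real ((W - 1) ^ j) / \<epsilon>" using real_arch_simple by blast
    show ?thesis
    proof (rule eventually_sequentiallyI[of "Suc M0"])
      fix M assume M: "Suc M0 \<le> M"
      have "card {n. n < M \<and> coset_avg F (rr n) \<noteq> y n} \<le> card {n. n < M \<and> \<not> has_z j n}"
        by (intro card_mono) (auto simp: y_def)
      also have "\<dots> \<le> (M div W ^ j + 1) * (W - 1) ^ j" by (rule card_not_has_z)
      finally have "real (card {n. n < M \<and> coset_avg F (rr n) \<noteq> y n})
          \<le> real ((M div W ^ j + 1) * (W - 1) ^ j)" by linarith
      also have "\<dots> = (real (M div W ^ j) + 1) * real ((W - 1) ^ j)"
        by (simp only: of_nat_mult of_nat_add of_nat_1)
      also have "\<dots> \<le> (real M / real (W ^ j) + 1) * real ((W - 1) ^ j)"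
        by (intro mult_right_mono add_mono of_nat_div_le_of_nat) auto
      also have "\<dots> = real M * \<rho> ^ j + real ((W - 1) ^ j)"
        by (simp add: \<rho>_def power_divide algebra_simps)
      also have "\<dots> \<le> real M * (\<epsilon> / 2) + real M * (\<epsilon> / 2)"
      proof (intro add_mono mult_left_mono)
        have "2 * real ((W - 1) ^ j) / \<epsilon> \<le> real M" using M M0 by linarith
        thus "real ((W - 1) ^ j) \<le> real M * (\<epsilon> / 2)" using \<epsilon> by (simp add: field_simps)
      qed (use j in auto)
      finally show "real (card {n. n < M \<and> coset_avg F (rr n) \<noteq> y n}) / real M \<le> \<epsilon>"
        using M by (simp add: field_simps)
    qed
  qed
  ultimately show "\<exists>y. periodic_seq y \<and> (\<forall>\<^sub>F M in sequentially.
      real (card {n. n < M \<and> coset_avg F (rr n) \<noteq> y n}) / real M \<le> \<epsilon>)" by blast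
qed

section \<open>Contraction on cubes\<close>

text \<open>Values such as \<open>rr n\<close> lie here; they need not lie in \<open>G\<close>, but
  \<open>e_R\<close> brings them there after multiplication by \<open>e\<close>.\<close>

definition R :: "'m set" where "R = {act t n * e | t n. True}"

lemma rr_R: "rr n \<in> R" by (auto simp: R_def rr_def)

lemma act_R: "r \<in> R \<Longrightarrow> act s n * r \<in> R"
proof -
  assume "r \<in> R"
  then obtain t m where r: "r = act t m * e" by (auto simp: R_def)
  have "act (s + t) (m * W ^ s + n mod W ^ s) = act s n * act t m"
    using W by (simp add: digit_act_append digit_act_mod)
  thus ?thesis unfolding R_def r by (metis (mono_tags, lifting) mem_Collect_eq mult.assoc)
qed

lemma e_R: "r \<in> R \<Longrightarrow> e * r \<in> G"
  using e_act_e_G by (auto simp: R_def mult.assoc)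

abbreviation box :: "nat \<Rightarrow> nat \<Rightarrow> (nat \<Rightarrow> nat) set" where
  "box d t \<equiv> {0..d} \<rightarrow>\<^sub>E {..<W ^ t}"

lemma finite_box: "finite (box d t)" by (intro finite_PiE) auto

lemma card_box: "card (box d t) = (W ^ t) ^ Suc d"
  by (subst card_PiE) auto

text \<open>
  The block consists of the digit \<open>z\<close>, a cube realising \<open>h\<close> at the top vertex, the digit \<open>z\<close> again, and
  enough zeros to absorb the incoming carry \<open>q\<close>; hence it emits no carry.
\<close>

lemma exchange:
  "\<exists>s c b. s > 0 \<and> inj_on c N \<and> (\<forall>h\<in>N. c h \<in> box d s \<and> (\<forall>\<omega>\<subseteq>{1..d}. \<forall>q\<le>d.
     vert (c h) \<omega> + q < W ^ s \<and> act s (vert (c h) \<omega> + q) = b q * single {1..d} h \<omega>))"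
proof -
  have "\<forall>h\<in>N. \<exists>x. \<forall>I\<subseteq>{1..d}. single {1..d} h I = lam (vert x I)"
    by (auto simp: N_def NN_def K_def)
  then obtain x where x: "\<And>h I. h \<in> N \<Longrightarrow> I \<subseteq> {1..d} \<Longrightarrow> single {1..d} h I = lam (vert (x h) I)"
    by metis
  define t where "t = (\<Sum>h\<in>N. vert (x h) {1..d})"
  \<comment> \<open>From the bottom: \<open>d\<close> zeros, which absorb a carry
    \<open>q \<le> d < W ^ d\<close>, then the digit \<open>z\<close>, then \<open>t\<close> digits
    for the cube, then \<open>z\<close> again. Both digits \<open>z\<close> are put into coordinate
    \<open>0\<close>, so each vertex gets them once.\<close>
  define s where "s = d + (1 + Suc t)"
  define c where "c h = (\<lambda>i\<in>{0..d}. (if i = 0 then (z * W ^ t * W + z) * W ^ d else 0) + x h i * W ^ Suc d)" for h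
  have lt: "v < W ^ t" if "h \<in> N" "v \<le> vert (x h) {1..d}" for h v
  proof -
    have "vert (x h) {1..d} \<le> t" unfolding t_def
      using that finite_N by (intro member_le_sum) auto
    thus ?thesis using that less_W_power[of t] by simp
  qed
  have vc: "vert (c h) \<omega> = ((z * W ^ t + vert (x h) \<omega>) * W + z) * W ^ d"
    if "\<omega> \<subseteq> {1..d}" for h \<omega>
  proof -
    have "(\<Sum>i\<in>\<omega>. c h i) = (\<Sum>i\<in>\<omega>. x h i * W ^ Suc d)"
      using that by (intro sum.cong) (auto simp: c_def)
    thus ?thesis
      by (simp add: vert_def c_def algebra_simps sum_distrib_left)
  qed
  have main: "vert (c h) \<omega> + q < W ^ s \<and> act s (vert (c h) \<omega> + q) = act d q * single {1..d} h \<omega>"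
    if h: "h \<in> N" and \<omega>: "\<omega> \<subseteq> {1..d}" and q: "q \<le> d" for h \<omega> q
  proof -
    define v where "v = vert (x h) \<omega>"
    have v: "v < W ^ t" unfolding v_def by (rule lt[OF h vert_mono[OF \<omega>]]) simp
    have q': "q < W ^ d" using q less_W_power[of d] by simp
    define a where "a = z * W ^ t + v"
    have "a < Suc z * W ^ t" using v by (simp add: a_def)
    also have "\<dots> \<le> W * W ^ t" using z by (intro mult_right_mono) auto
    finally have a: "a < W * W ^ t" .
    have b: "a * W + z < W * W ^ t * W"
    proof -
      have "a * W + z < Suc a * W" using z by simp
      also have "\<dots> \<le> W * W ^ t * W" using a by (intro mult_right_mono) auto
      finally show ?thesis .
    qed
    have "(a * W + z) * W ^ d + q < Suc (a * W + z) * W ^ d" using q' by simp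
    also have "\<dots> \<le> W * W ^ t * W * W ^ d" using b by (intro mult_right_mono) auto
    also have "\<dots> = W ^ s" by (simp add: s_def power_add)
    finally have 1: "(a * W + z) * W ^ d + q < W ^ s" .
    have "act s ((a * W + z) * W ^ d + q) = act d q * act (1 + Suc t) (a * W + z)"
      unfolding s_def using q' W by (subst digit_act_append) auto
    also have "act (1 + Suc t) (a * W + z) = e * act (Suc t) a"
      using z by simp
    also have "act (Suc t) a = act t v * e" unfolding a_def by (rule act_z[OF v])
    also have "e * (act t v * e) = single {1..d} h \<omega>"
      using x[OF h \<omega>] lam_eq[OF v] by (simp add: v_def mult.assoc)
    finally show ?thesis using 1 vc[OF \<omega>, of h] by (simp add: a_def v_def)
  qed
  \<comment> \<open>The top vertex determines \<open>h\<close>. Injectivity allows the sum over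
    \<open>N\<close> to be read as a sum over distinct cubes of the box.\<close>
  have "inj_on c N"
  proof (rule inj_onI)
    fix h h' assume hh: "h \<in> N" "h' \<in> N" "c h = c h'"
    have "vert (x h) {1..d} = vert (x h') {1..d}"
      using vc[of "{1..d}" h] vc[of "{1..d}" h'] hh(3) W by simp
    hence "single {1..d} h {1..d} = single {1..d} h' {1..d}" using x hh by simp
    thus "h = h'" by (simp add: single_def)
  qed
  moreover have "c h \<in> box d s" if h: "h \<in> N" for h
  proof -
    have "c h i < W ^ s" if i: "i \<in> {0..d}" for i
    proof -
      have "c h i \<le> vert (c h) {1..d}"
      proof (cases "i = 0")
        case False
        hence "c h i \<le> (\<Sum>i\<in>{1..d}. c h i)" using i by (intro member_le_sum) auto
        thus ?thesis by (simp add: vert_def)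
      qed (simp add: vert_def)
      thus ?thesis using main[OF h, of "{1..d}" 0] by simp
    qed
    thus ?thesis by (auto simp: c_def PiE_iff)
  qed
  moreover have "s > 0" by (simp add: s_def)
  ultimately show ?thesis using main
    by (intro exI[of _ s] exI[of _ c] exI[of _ "act d"]) blast
qed

text \<open>
  \<open>r \<omega>\<close> is the carry coming in from the lower digits at the vertex \<open>\<omega>\<close>, and \<open>\<rho> \<omega> c\<close> is the state reached
  by the higher digits when they receive the carry \<open>c\<close>.
\<close>

definition cube_sum ::
  "nat \<Rightarrow> nat \<Rightarrow> (nat set \<Rightarrow> nat) \<Rightarrow> (nat set \<Rightarrow> nat \<Rightarrow> 'm) \<Rightarrow> ((nat set \<Rightarrow> 'm) \<Rightarrow> complex) \<Rightarrow> complex"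
where
  "cube_sum d t r \<rho> \<Psi> = (\<Sum>x\<in>box d t. \<Psi> (\<lambda>\<omega>\<in>Pow {1..d}.
     act t (vert x \<omega> + r \<omega>) * \<rho> \<omega> ((vert x \<omega> + r \<omega>) div W ^ t)))"

lemma vert_restrict:
  "\<omega> \<subseteq> {1..d} \<Longrightarrow> vert (\<lambda>i\<in>{0..d}. x i * M + y i) \<omega> = vert x \<omega> * M + vert y \<omega>"
proof -
  assume \<omega>: "\<omega> \<subseteq> {1..d}"
  have "(\<Sum>i\<in>\<omega>. (\<lambda>i\<in>{0..d}. x i * M + y i) i) = (\<Sum>i\<in>\<omega>. x i * M + y i)"
    using \<omega> by (intro sum.cong) auto
  also have "\<dots> = (\<Sum>i\<in>\<omega>. x i) * M + (\<Sum>i\<in>\<omega>. y i)" by (simp add: sum.distrib sum_distrib_right)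
  finally show ?thesis unfolding vert_def by (simp add: distrib_right)
qed

text \<open>The action of the lowest \<open>s\<close> digits multiplies from the left inside
  \<open>\<Psi>\<close>, and their overflow becomes the incoming carry of the remaining
  \<open>t\<close> digits.\<close>

lemma cube_sum_split:
  "cube_sum d (s + t) r \<rho> \<Psi> = (\<Sum>x\<in>box d s. cube_sum d t (\<lambda>\<omega>. (vert x \<omega> + r \<omega>) div W ^ s) \<rho>
     (\<lambda>\<sigma>. \<Psi> (\<lambda>\<omega>\<in>Pow {1..d}. act s (vert x \<omega> + r \<omega>) * \<sigma> \<omega>)))"
proof -
  have "cube_sum d (s + t) r \<rho> \<Psi> = (\<Sum>y\<in>box d s. \<Sum>x\<in>box d t. \<Psi> (\<lambda>\<omega>\<in>Pow {1..d}.
     act (s + t) (vert (\<lambda>i\<in>{0..d}. x i * W ^ s + y i) \<omega> + r \<omega>) *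
     \<rho> \<omega> ((vert (\<lambda>i\<in>{0..d}. x i * W ^ s + y i) \<omega> + r \<omega>) div W ^ (s + t))))"
    unfolding cube_sum_def
  proof (rule sum_PiE_split[where \<alpha> = "\<lambda>n. n div W ^ s" and \<beta> = "\<lambda>n. n mod W ^ s"])
    fix a b assume "a \<in> {..<W ^ t}" "b \<in> {..<W ^ s}"
    hence "b < W ^ s" "Suc a \<le> W ^ t" by auto
    have "a * W ^ s + b < Suc a * W ^ s" using \<open>b < W ^ s\<close> by simp
    also have "\<dots> \<le> W ^ t * W ^ s" using \<open>Suc a \<le> W ^ t\<close> by (rule mult_right_mono) simp
    finally show "a * W ^ s + b \<in> {..<W ^ (s + t)} \<and> (a * W ^ s + b) div W ^ s = a \<and>
        (a * W ^ s + b) mod W ^ s = b"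
      using \<open>b < W ^ s\<close> W by (simp add: power_add mult.commute)
  next
    fix c assume "c \<in> {..<W ^ (s + t)}"
    thus "c div W ^ s \<in> {..<W ^ t} \<and> c mod W ^ s \<in> {..<W ^ s} \<and> c div W ^ s * W ^ s + c mod W ^ s = c"
      using W by (simp add: less_mult_imp_div_less power_add mult.commute)
  qed
  also have "\<dots> = (\<Sum>y\<in>box d s. \<Sum>x\<in>box d t. \<Psi> (\<lambda>\<omega>\<in>Pow {1..d}.
     act s (vert y \<omega> + r \<omega>) * (act t (vert x \<omega> + (vert y \<omega> + r \<omega>) div W ^ s) *
     \<rho> \<omega> ((vert x \<omega> + (vert y \<omega> + r \<omega>) div W ^ s) div W ^ t))))"
  proof (intro sum.cong refl arg_cong[where f = \<Psi>] restrict_ext)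
    fix x y \<omega> assume \<omega>: "\<omega> \<in> Pow {1..d}"
    define m where "m = vert y \<omega> + r \<omega>"
    have v: "vert (\<lambda>i\<in>{0..d}. x i * W ^ s + y i) \<omega> + r \<omega> = vert x \<omega> * W ^ s + m"
      using vert_restrict[of \<omega> d x "W ^ s" y] \<omega> by (simp add: m_def)
    have "(vert x \<omega> * W ^ s + m) div W ^ (s + t) = (vert x \<omega> + m div W ^ s) div W ^ t"
      using W by (simp add: power_add div_mult2_eq)
    thus "act (s + t) (vert (\<lambda>i\<in>{0..d}. x i * W ^ s + y i) \<omega> + r \<omega>) *
        \<rho> \<omega> ((vert (\<lambda>i\<in>{0..d}. x i * W ^ s + y i) \<omega> + r \<omega>) div W ^ (s + t)) =
        act s (vert y \<omega> + r \<omega>) * (act t (vert x \<omega> + (vert y \<omega> + r \<omega>) div W ^ s) *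
        \<rho> \<omega> ((vert x \<omega> + (vert y \<omega> + r \<omega>) div W ^ s) div W ^ t))"
      unfolding v by (simp add: digit_act_append W0 mult.assoc m_def)
  qed
  also have "\<dots> = (\<Sum>x\<in>box d s. cube_sum d t (\<lambda>\<omega>. (vert x \<omega> + r \<omega>) div W ^ s) \<rho>
     (\<lambda>\<sigma>. \<Psi> (\<lambda>\<omega>\<in>Pow {1..d}. act s (vert x \<omega> + r \<omega>) * \<sigma> \<omega>)))"
    unfolding cube_sum_def
    by (intro sum.cong refl arg_cong[where f = \<Psi>] restrict_ext) auto
  finally show ?thesis .
qed

section \<open>Cancellation and decay of cube sums\<close>

definition mean_zero :: "nat \<Rightarrow> ((nat set \<Rightarrow> 'm) \<Rightarrow> complex) \<Rightarrow> bool" where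
  "mean_zero d \<Psi> \<longleftrightarrow> (\<forall>\<sigma>. (\<Sum>h\<in>N. \<Psi> (\<sigma>({1..d} := \<sigma> {1..d} * h))) = 0)"

text \<open>Left multiplication does not interfere with the right multiplication by \<open>h\<close>
  at the top vertex.\<close>

lemma mean_zero_act:
  assumes "mean_zero d \<Psi>"
  shows "mean_zero d (\<lambda>\<sigma>. \<Psi> (\<lambda>\<omega>\<in>Pow {1..d}. a \<omega> * \<sigma> \<omega>))"
  unfolding mean_zero_def
proof
  fix \<sigma>
  define \<sigma>' where "\<sigma>' = (\<lambda>\<omega>\<in>Pow {1..d}. a \<omega> * \<sigma> \<omega>)"
  have "(\<lambda>\<omega>\<in>Pow {1..d}. a \<omega> * (\<sigma>({1..d} := \<sigma> {1..d} * h)) \<omega>) = \<sigma>'({1..d} := \<sigma>' {1..d} * h)" for h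
    by (auto simp: \<sigma>'_def fun_eq_iff mult.assoc)
  thus "(\<Sum>h\<in>N. \<Psi> (\<lambda>\<omega>\<in>Pow {1..d}. a \<omega> * (\<sigma>({1..d} := \<sigma> {1..d} * h)) \<omega>)) = 0"
    using assms by (simp add: mean_zero_def)
qed

text \<open>At most \<open>d + 1\<close> summands, each at most \<open>W ^ s - 1\<close>, together
  with a carry of at most \<open>d\<close> stay below \<open>(d + 1) * W ^ s\<close>. So the bound
  \<open>d\<close> on carries reproduces itself.\<close>

lemma carry_bound:
  assumes x: "x \<in> box d s" and \<omega>: "\<omega> \<subseteq> {1..d}" and r: "r \<le> d"
  shows "(vert x \<omega> + r) div W ^ s \<le> d"
proof -
  have le: "x i \<le> W ^ s - 1" if "i \<in> {0..d}" for i using x that by (force simp: PiE_iff)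
  have "vert x \<omega> \<le> vert x {1..d}" using \<omega> by (intro vert_mono) auto
  also have "\<dots> \<le> (W ^ s - 1) + (\<Sum>i\<in>{1..d}. W ^ s - 1)"
    unfolding vert_def by (intro add_mono sum_mono le) auto
  also have "\<dots> = Suc d * (W ^ s - 1)" by simp
  finally have "vert x \<omega> + r < Suc d * (W ^ s - 1) + Suc d" using r by simp
  also have "\<dots> = Suc d * Suc (W ^ s - 1)" by (simp only: mult_Suc_right add.commute)
  also have "Suc (W ^ s - 1) = W ^ s" using W by simp
  finally have "vert x \<omega> + r < Suc d * W ^ s" .
  hence "(vert x \<omega> + r) div W ^ s < Suc d" by (rule less_mult_imp_div_less)
  thus ?thesis by simp
qed

text \<open>At the top vertex \<open>h\<close> stands to the left of
  \<open>e * \<sigma> {1..d}\<close>, an element of \<open>G\<close>; by normality the sum over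
  \<open>N\<close> may put it on the right, where \<open>mean_zero\<close> applies.\<close>

lemma cube_sum_exchange:
  assumes m: "mean_zero d \<Psi>" and \<rho>: "\<And>c. \<rho> {1..d} c \<in> R"
  shows "(\<Sum>h\<in>N. cube_sum d t r \<rho> (\<lambda>\<sigma>. \<Psi> (\<lambda>\<omega>\<in>Pow {1..d}. b \<omega> * single {1..d} h \<omega> * \<sigma> \<omega>))) = 0"
proof -
  have zero: "(\<Sum>h\<in>N. \<Psi> (\<lambda>\<omega>\<in>Pow {1..d}. b \<omega> * single {1..d} h \<omega> * \<sigma> \<omega>)) = 0"
    if \<sigma>: "\<sigma> {1..d} \<in> R" for \<sigma>
  proof -
    define D where "D = {1..d}"
    define \<sigma>' where "\<sigma>' = (\<lambda>\<omega>\<in>Pow D. b \<omega> * e * \<sigma> \<omega>)"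
    define g where "g = e * \<sigma> D"
    have g: "g \<in> G" using \<sigma> e_R by (simp add: g_def D_def)
    have "(\<lambda>\<omega>\<in>Pow D. b \<omega> * single D h \<omega> * \<sigma> \<omega>) = \<sigma>'(D := b D * (h * g))" if "h \<in> N" for h
    proof -
      have "h * g = h * \<sigma> D" using that by (simp add: g_def N_G flip: mult.assoc)
      thus ?thesis by (auto simp: \<sigma>'_def fun_eq_iff single_def mult.assoc)
    qed
    hence "(\<Sum>h\<in>N. \<Psi> (\<lambda>\<omega>\<in>Pow D. b \<omega> * single D h \<omega> * \<sigma> \<omega>)) =
        (\<Sum>h\<in>N. \<Psi> (\<sigma>'(D := b D * (h * g))))" by (intro sum.cong) auto
    also have "\<dots> = (\<Sum>h\<in>N. \<Psi> (\<sigma>'(D := b D * (g * h))))"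
      by (rule sum_N_conj[OF g, of "\<lambda>y. \<Psi> (\<sigma>'(D := b D * y))"])
    also have "\<dots> = (\<Sum>h\<in>N. \<Psi> (\<sigma>'(D := \<sigma>' D * h)))"
      by (simp add: \<sigma>'_def g_def mult.assoc)
    also have "\<dots> = 0" using m by (simp add: mean_zero_def D_def)
    finally show ?thesis by (simp add: D_def)
  qed
  show ?thesis
    unfolding cube_sum_def
  proof (subst sum.swap, rule sum.neutral, rule ballI)
    fix x
    show "(\<Sum>h\<in>N. \<Psi> (\<lambda>\<omega>\<in>Pow {1..d}. b \<omega> * single {1..d} h \<omega> *
        (\<lambda>\<omega>\<in>Pow {1..d}. act t (vert x \<omega> + r \<omega>) * \<rho> \<omega> ((vert x \<omega> + r \<omega>) div W ^ t)) \<omega>)) = 0"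
      by (rule zero) (simp add: act_R \<rho>[unfolded One_nat_def])
  qed
qed

text \<open>Split off the lowest \<open>s\<close> digits. The cubes supplied by
  \<open>exchange\<close> cancel among themselves, so at least one of the
  \<open>(W ^ s) ^ Suc d\<close> low blocks is saved; the others again have carries at most
  \<open>d\<close> and mean zero, and the induction continues.\<close>

lemma cube_sum_decay:
  "\<exists>s>0. \<forall>j r \<rho> \<Psi> B. (\<forall>\<omega>\<subseteq>{1..d}. r \<omega> \<le> d) \<longrightarrow> (\<forall>c. \<rho> {1..d} c \<in> R) \<longrightarrow> mean_zero d \<Psi> \<longrightarrow>
     (\<forall>\<sigma>. cmod (\<Psi> \<sigma>) \<le> B) \<longrightarrow>
     cmod (cube_sum d (s * j) r \<rho> \<Psi>) \<le> B * real ((W ^ s) ^ Suc d - 1) ^ j"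
proof -
  obtain s c b where ex: "s > 0 \<and> inj_on c N \<and> (\<forall>h\<in>N. c h \<in> box d s \<and> (\<forall>\<omega>\<subseteq>{1..d}. \<forall>q\<le>d.
     vert (c h) \<omega> + q < W ^ s \<and> act s (vert (c h) \<omega> + q) = b q * single {1..d} h \<omega>))"
    using exchange[of d] by (elim exE)
  hence s: "s > 0" and inj: "inj_on c N" and c: "\<And>h. h \<in> N \<Longrightarrow> c h \<in> box d s"
    and v: "\<And>h \<omega> q. h \<in> N \<Longrightarrow> \<omega> \<subseteq> {1..d} \<Longrightarrow> q \<le> d \<Longrightarrow>
      vert (c h) \<omega> + q < W ^ s \<and> act s (vert (c h) \<omega> + q) = b q * single {1..d} h \<omega>"
    by simp_all
  have "cmod (cube_sum d (s * j) r \<rho> \<Psi>) \<le> B * real ((W ^ s) ^ Suc d - 1) ^ j"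
    if "\<forall>\<omega>\<subseteq>{1..d}. r \<omega> \<le> d" "\<forall>c. \<rho> {1..d} c \<in> R" "mean_zero d \<Psi>" "\<forall>\<sigma>. cmod (\<Psi> \<sigma>) \<le> B"
    for j r \<rho> \<Psi> B
    using that
  proof (induction j arbitrary: r \<Psi>)
    case 0
    have "cmod (cube_sum d 0 r \<rho> \<Psi>) \<le> (\<Sum>x\<in>box d 0. B)"
      unfolding cube_sum_def by (rule sum_norm_le) (use 0 in auto)
    thus ?case using card_box[of d 0] by simp
  next
    case (Suc j)
    define g where "g x = cube_sum d (s * j) (\<lambda>\<omega>. (vert x \<omega> + r \<omega>) div W ^ s) \<rho>
     (\<lambda>\<sigma>. \<Psi> (\<lambda>\<omega>\<in>Pow {1..d}. act s (vert x \<omega> + r \<omega>) * \<sigma> \<omega>))" for x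
    have "cube_sum d (s * Suc j) r \<rho> \<Psi> = (\<Sum>x\<in>box d s. g x)"
      using cube_sum_split[of d s "s * j" r \<rho> \<Psi>] by (simp add: g_def)
    also have "\<dots> = (\<Sum>x\<in>box d s - c ` N. g x) + (\<Sum>x\<in>c ` N. g x)"
      by (rule sum.subset_diff) (use c finite_box in auto)
    also have "(\<Sum>x\<in>c ` N. g x) = (\<Sum>h\<in>N. g (c h))"
      using inj by (simp add: sum.reindex)
    \<comment> \<open>These cubes emit no carry, and their action at a vertex depends on
      \<open>h\<close> only through \<open>single {1..d} h\<close>, so the summands fit
      \<open>cube_sum_exchange\<close>.\<close>
    also have "\<dots> = (\<Sum>h\<in>N. cube_sum d (s * j) (\<lambda>_. 0) \<rho>
        (\<lambda>\<sigma>. \<Psi> (\<lambda>\<omega>\<in>Pow {1..d}. b (r \<omega>) * single {1..d} h \<omega> * \<sigma> \<omega>)))"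
    proof (rule sum.cong[OF refl])
      fix h assume h: "h \<in> N"
      have "(\<lambda>\<omega>\<in>Pow {1..d}. act s (vert (c h) \<omega> + r \<omega>) * \<sigma> \<omega>) =
          (\<lambda>\<omega>\<in>Pow {1..d}. b (r \<omega>) * single {1..d} h \<omega> * \<sigma> \<omega>)" for \<sigma>
        using v[OF h] Suc.prems(1) by (intro restrict_ext) auto
      moreover have "(vert (c h) \<omega> + r \<omega>) div W ^ s = 0" if "\<omega> \<in> Pow {1..d}" for \<omega>
        using v[OF h, of \<omega> "r \<omega>"] Suc.prems(1) that by auto
      ultimately show "g (c h) = cube_sum d (s * j) (\<lambda>_. 0) \<rho>
        (\<lambda>\<sigma>. \<Psi> (\<lambda>\<omega>\<in>Pow {1..d}. b (r \<omega>) * single {1..d} h \<omega> * \<sigma> \<omega>))"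
        unfolding g_def cube_sum_def by (simp cong: restrict_cong)
    qed
    also have "\<dots> = 0" by (rule cube_sum_exchange) (use Suc.prems in auto)
    finally have eq: "cube_sum d (s * Suc j) r \<rho> \<Psi> = (\<Sum>x\<in>box d s - c ` N. g x)" by simp
    have B: "B \<ge> 0" using Suc.prems(4) norm_ge_zero order_trans by blast
    have "cmod (cube_sum d (s * Suc j) r \<rho> \<Psi>) \<le>
        (\<Sum>x\<in>box d s - c ` N. B * real ((W ^ s) ^ Suc d - 1) ^ j)"
      unfolding eq
    proof (rule sum_norm_le)
      fix x assume x: "x \<in> box d s - c ` N"
      show "cmod (g x) \<le> B * real ((W ^ s) ^ Suc d - 1) ^ j"
        unfolding g_def
      proof (rule Suc.IH)
        show "mean_zero d (\<lambda>\<sigma>. \<Psi> (\<lambda>\<omega>\<in>Pow {1..d}. act s (vert x \<omega> + r \<omega>) * \<sigma> \<omega>))"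
          by (rule mean_zero_act[OF Suc.prems(3)])
      qed (use x Suc.prems in \<open>auto intro!: carry_bound\<close>)
    qed
    also have "\<dots> = real (card (box d s - c ` N)) * (B * real ((W ^ s) ^ Suc d - 1) ^ j)" by simp
    also have "\<dots> \<le> real ((W ^ s) ^ Suc d - 1) * (B * real ((W ^ s) ^ Suc d - 1) ^ j)"
    proof (rule mult_right_mono)
      have "card (box d s - c ` N) = card (box d s) - card (c ` N)"
        using c finite_N by (intro card_Diff_subset) auto
      also have "\<dots> \<le> (W ^ s) ^ Suc d - 1"
        using card_N card_image[OF inj] by (simp add: card_box del: power_Suc)
      finally show "real (card (box d s - c ` N)) \<le> real ((W ^ s) ^ Suc d - 1)" by linarith
    qed (use B in auto)
    finally show ?case by (simp add: algebra_simps)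
  qed
  thus ?thesis using s by blast
qed

end

section \<open>Gowers norms as sums over integer boxes\<close>

definition ivert :: "(nat \<Rightarrow> int) \<Rightarrow> nat set \<Rightarrow> int" where
  "ivert n \<omega> = n 0 + (\<Sum>i\<in>\<omega>. n i)"

definition cube_term :: "nat \<Rightarrow> (int \<Rightarrow> complex) \<Rightarrow> (nat set \<Rightarrow> int) \<Rightarrow> complex" where
  "cube_term d f x = (\<Prod>\<omega>\<in>Pow {1..d}. (cnj ^^ card \<omega>) (f (x \<omega>)))"

text \<open>The half-open range makes \<open>{-(Y * M)..<Y * M}\<close> split exactly into blocks of
  length \<open>M\<close>.\<close>

definition box_sum :: "nat \<Rightarrow> int \<Rightarrow> (int \<Rightarrow> complex) \<Rightarrow> complex" where
  "box_sum d Y f = (\<Sum>n\<in>{0..d} \<rightarrow>\<^sub>E {-Y..<Y}. cube_term d f (ivert n))"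

lemma funpow_cnj_simps [simp]:
  "(cnj ^^ n) 0 = 0" "(cnj ^^ n) 1 = 1" "cmod ((cnj ^^ n) z) = cmod z"
  by (induction n) auto

lemma funpow_cnj_sum: "(cnj ^^ n) (\<Sum>i\<in>A. f i) = (\<Sum>i\<in>A. (cnj ^^ n) (f i))"
  by (induction n) auto

lemma cube_term_eq_0: "\<omega> \<subseteq> {1..d} \<Longrightarrow> f (x \<omega>) = 0 \<Longrightarrow> cube_term d f x = 0"
  unfolding cube_term_def by (intro prod_zero bexI[of _ \<omega>]) auto

lemma cube_term_bound:
  assumes "\<And>y. cmod (f y) \<le> B"
  shows "cmod (cube_term d f x) \<le> B ^ 2 ^ d"
proof -
  have "cmod (cube_term d f x) \<le> (\<Prod>\<omega>\<in>Pow {1..d}. B)"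
    unfolding cube_term_def prod_norm[symmetric] by (rule prod_mono) (use assms in auto)
  thus ?thesis by (simp add: card_Pow)
qed

lemma integer_mod_group_finprod:
  assumes "p > 0" "finite \<omega>" "\<And>i. i \<in> \<omega> \<Longrightarrow> v i \<in> {0..<int p}"
  shows "finprod (integer_mod_group p) v \<omega> = (\<Sum>i\<in>\<omega>. v i) mod int p"
proof -
  interpret comm_group "integer_mod_group p" by (rule abelian_integer_mod_group)
  show ?thesis using assms(2,3)
  proof (induction \<omega> rule: finite_induct)
    case empty
    thus ?case by (simp add: one_integer_mod_group)
  next
    case (insert x A)
    have "finprod (integer_mod_group p) v (insert x A) =
        v x \<otimes>\<^bsub>integer_mod_group p\<^esub> finprod (integer_mod_group p) v A"
      using insert assms(1) by (intro finprod_insert) (auto simp: carrier_integer_mod_group)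
    thus ?case using insert assms(1) by (simp add: mult_integer_mod_group mod_simps)
  qed
qed

lemma gowers_average_integer_mod:
  assumes "p > 0"
  shows "gowers_average d (integer_mod_group p) f =
    (\<Sum>v\<in>{0..d} \<rightarrow>\<^sub>E {0..<int p}. cube_term d f (\<lambda>\<omega>. ivert v \<omega> mod int p)) / of_nat (p ^ (d + 1))"
proof -
  have "v 0 \<otimes>\<^bsub>integer_mod_group p\<^esub> finprod (integer_mod_group p) v \<omega> = ivert v \<omega> mod int p"
    if "v \<in> {0..d} \<rightarrow>\<^sub>E {0..<int p}" "\<omega> \<in> Pow {1..d}" for v \<omega>
  proof -
    have "finite \<omega>" using that finite_subset by auto
    moreover have "v i \<in> {0..<int p}" if "i \<in> \<omega>" for i
      using that \<open>v \<in> _\<close> \<open>\<omega> \<in> _\<close> by (auto simp: PiE_iff)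
    ultimately show ?thesis using assms
      by (simp add: integer_mod_group_finprod mult_integer_mod_group ivert_def mod_simps)
  qed
  thus ?thesis using assms
    by (simp add: gowers_average_def carrier_integer_mod_group cube_term_def)
qed

text \<open>
  As \<open>p > 2 d N\<close>, a cube modulo \<open>p\<close> with all vertices in \<open>{0..<N}\<close> lifts uniquely to an integer cube
  with sides in \<open>(-N, N)\<close>.
\<close>

lemma cube_no_wrap:
  fixes p N Y :: int
  assumes d: "d \<ge> 1" and N: "N \<ge> 1" and p: "p > 2 * int d * N" and Y: "Y \<ge> N"
    and f: "\<And>x. x \<notin> {0..<N} \<Longrightarrow> f x = 0"
  shows "(\<Sum>v\<in>{0..d} \<rightarrow>\<^sub>E {0..<p}. cube_term d f (\<lambda>\<omega>. ivert v \<omega> mod p)) = box_sum d Y f"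
proof -
  have "1 * N \<le> int d * N" using d N by (intro mult_right_mono) auto
  hence dN: "N \<le> int d * N" by simp
  have p: "p > 2 * (int d * N)" using p by simp
  have p2: "p > 2 * N" "p > N" "p > 0" using p N dN by linarith+
  define S where "S = {v \<in> {0..d} \<rightarrow>\<^sub>E {0..<p}. \<forall>\<omega>\<subseteq>{1..d}. ivert v \<omega> mod p \<in> {0..<N}}"
  define T where "T = {n \<in> {0..d} \<rightarrow>\<^sub>E {-Y..<Y}. \<forall>\<omega>\<subseteq>{1..d}. ivert n \<omega> \<in> {0..<N}}"
  have zero: "cube_term d f x = 0" if "\<not> (\<forall>\<omega>\<subseteq>{1..d}. x \<omega> \<in> {0..<N})" for x
    using that f cube_term_eq_0[of _ d f x] by blast
  have "(\<Sum>v\<in>{0..d} \<rightarrow>\<^sub>E {0..<p}. cube_term d f (\<lambda>\<omega>. ivert v \<omega> mod p)) =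
      (\<Sum>v\<in>S. cube_term d f (\<lambda>\<omega>. ivert v \<omega> mod p))"
    by (rule sum.mono_neutral_right) (auto simp: S_def intro!: zero finite_PiE)
  \<comment> \<open>Residues from \<open>p - N\<close> on stand for negative coordinates.\<close>
  also have "\<dots> = (\<Sum>n\<in>T. cube_term d f (ivert n))"
  proof (rule sum.reindex_bij_witness[of _ "\<lambda>n. \<lambda>i\<in>{0..d}. n i mod p"
        "\<lambda>v. \<lambda>i\<in>{0..d}. if v i \<ge> p - N then v i - p else v i"])
    fix v assume v: "v \<in> S"
    define n where "n = (\<lambda>i\<in>{0..d}. if v i \<ge> p - N then v i - p else v i)"
    have vb: "v i \<in> {0..<p}" if "i \<le> d" for i using v that by (auto simp: S_def PiE_iff)
    have iv: "ivert v \<omega> mod p \<in> {0..<N}" if "\<omega> \<subseteq> {1..d}" for \<omega> using v that by (auto simp: S_def)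
    have v0: "v 0 < N" "v 0 \<ge> 0" using iv[of "{}"] vb[of 0] by (simp_all add: ivert_def)
    have n0: "n 0 = v 0" using v0 p2 by (simp add: n_def)
    have nb: "-N \<le> n i" "n i < N" if "i \<in> {1..d}" for i
    proof -
      have vi: "0 \<le> v i" "v i < p" using vb that by auto
      \<comment> \<open>Otherwise the vertex \<open>{i}\<close> would leave
        \<open>{0..<N}\<close>.\<close>
      have "v 0 + v i < N \<or> v 0 + v i \<ge> p"
      proof (rule ccontr)
        assume "\<not> ?thesis"
        hence "(v 0 + v i) mod p = v 0 + v i" "v 0 + v i \<ge> N" using v0 vi by auto
        thus False using iv[of "{i}"] that by (simp add: ivert_def)
      qed
      thus "-N \<le> n i" "n i < N" using v0 vi p2 that by (auto simp: n_def)
    qed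
    have nmod: "n i mod p = v i" if "i \<le> d" for i
      using vb[OF that] that by (simp add: n_def minus_mod_self2)
    show "(\<lambda>i\<in>{0..d}. (\<lambda>i\<in>{0..d}. if v i \<ge> p - N then v i - p else v i) i mod p) = v"
      using v nmod unfolding n_def[symmetric]
      by (auto simp: fun_eq_iff S_def PiE_iff extensional_def)
    have ivm: "ivert n \<omega> mod p = ivert v \<omega> mod p" if "\<omega> \<subseteq> {1..d}" for \<omega>
    proof -
      have "(\<Sum>i\<in>\<omega>. n i) mod p = (\<Sum>i\<in>\<omega>. n i mod p) mod p" by (simp add: mod_sum_eq)
      also have "(\<Sum>i\<in>\<omega>. n i mod p) = (\<Sum>i\<in>\<omega>. v i)"
        using that by (intro sum.cong nmod) auto
      finally show ?thesis unfolding ivert_def n0 by (metis mod_add_right_eq)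
    qed
    \<comment> \<open>The lifted vertex lies between \<open>- d N\<close> and
      \<open>N + d N\<close>. A negative one would have residue above \<open>d N\<close>, hence at
      least \<open>N\<close>; and \<open>N + d N \<le> 2 d N < p\<close> excludes wrapping from
      above.\<close>
    have ivn: "ivert n \<omega> = ivert v \<omega> mod p" if \<omega>: "\<omega> \<subseteq> {1..d}" for \<omega>
    proof -
      have c: "card \<omega> \<le> d" "finite \<omega>" using card_mono[OF _ \<omega>] finite_subset[OF \<omega>] by auto
      have cN: "int (card \<omega>) * N \<le> int d * N" using c N by (intro mult_right_mono) auto
      have "(\<Sum>i\<in>\<omega>. n i) \<le> (\<Sum>i\<in>\<omega>. N)" using nb \<omega> by (intro sum_mono less_imp_le) auto
      hence "(\<Sum>i\<in>\<omega>. n i) \<le> int d * N" using cN by (simp del: mult_le_cancel_right)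
      hence u: "ivert n \<omega> < N + int d * N" using v0 n0 by (simp add: ivert_def)
      have "(\<Sum>i\<in>\<omega>. n i) \<ge> (\<Sum>i\<in>\<omega>. -N)" using nb \<omega> by (intro sum_mono) auto
      hence "(\<Sum>i\<in>\<omega>. n i) \<ge> - (int d * N)" using cN by (simp del: mult_le_cancel_right)
      hence l: "ivert n \<omega> \<ge> - (int d * N)" using v0 n0 by (simp add: ivert_def)
      have m: "ivert n \<omega> mod p < N" using iv[OF \<omega>] ivm[OF \<omega>] by simp
      have "ivert n \<omega> \<ge> 0"
      proof (rule ccontr)
        assume "\<not> ?thesis"
        hence "(ivert n \<omega> + p) mod p = ivert n \<omega> + p" using l p dN p2 by (intro mod_pos_pos_trivial) auto
        thus False using m l p dN N by simp
      qed
      moreover have "ivert n \<omega> < p" using u p dN by simp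
      ultimately show ?thesis using ivm[OF \<omega>] by simp
    qed
    show "(\<lambda>i\<in>{0..d}. if v i \<ge> p - N then v i - p else v i) \<in> T"
    proof -
      have "n i \<in> {-Y..<Y}" if "i \<le> d" for i
        using nb[of i] n0 v0 Y that by (cases "i = 0") auto
      hence "n \<in> {0..d} \<rightarrow>\<^sub>E {-Y..<Y}" by (auto simp: PiE_iff n_def)
      moreover have "\<forall>\<omega>\<subseteq>{1..d}. ivert n \<omega> \<in> {0..<N}" using ivn iv by simp
      ultimately show ?thesis unfolding T_def n_def[symmetric] by blast
    qed
    show "cube_term d f (ivert (\<lambda>i\<in>{0..d}. if v i \<ge> p - N then v i - p else v i)) =
        cube_term d f (\<lambda>\<omega>. ivert v \<omega> mod p)"
      unfolding n_def[symmetric] cube_term_def using ivn by (intro prod.cong) auto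
  next
    fix n assume n: "n \<in> T"
    define v where "v = (\<lambda>i\<in>{0..d}. n i mod p)"
    have iv: "ivert n \<omega> \<in> {0..<N}" if "\<omega> \<subseteq> {1..d}" for \<omega> using n that by (auto simp: T_def)
    have n0: "0 \<le> n 0" "n 0 < N" using iv[of "{}"] by (auto simp: ivert_def)
    have ni: "-N < n i" "n i < N" if "i \<le> d" for i
      using iv[of "{i}"] n0 that by (cases "i = 0"; force simp: ivert_def)+
    show "(\<lambda>i\<in>{0..d}. if (\<lambda>i\<in>{0..d}. n i mod p) i \<ge> p - N then (\<lambda>i\<in>{0..d}. n i mod p) i - p
        else (\<lambda>i\<in>{0..d}. n i mod p) i) = n"
    proof
      fix i
      consider "i > d" | "i \<le> d" "n i \<ge> 0" | "i \<le> d" "n i < 0" by linarith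
      thus "(\<lambda>i\<in>{0..d}. if (\<lambda>i\<in>{0..d}. n i mod p) i \<ge> p - N then (\<lambda>i\<in>{0..d}. n i mod p) i - p
        else (\<lambda>i\<in>{0..d}. n i mod p) i) i = n i"
      proof cases
        case 1
        thus ?thesis using n by (auto simp: T_def PiE_iff extensional_def)
      next
        case 2
        hence "n i mod p = n i" using ni[of i] p2 by (intro mod_pos_pos_trivial) auto
        thus ?thesis using 2 ni[of i] p2 by simp
      next
        case 3
        hence "(n i + p) mod p = n i + p" using ni[of i] p2 by (intro mod_pos_pos_trivial) auto
        thus ?thesis using 3 ni[of i] p2 by simp
      qed
    qed
    have ivm: "ivert v \<omega> mod p = ivert n \<omega>" if "\<omega> \<subseteq> {1..d}" for \<omega>
    proof -
      have "(\<Sum>i\<in>\<omega>. v i) = (\<Sum>i\<in>\<omega>. n i mod p)" using that by (intro sum.cong) (auto simp: v_def)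
      hence "ivert v \<omega> mod p = ivert n \<omega> mod p"
        unfolding ivert_def by (simp add: v_def) (metis mod_add_eq mod_sum_eq mod_mod_trivial)
      thus ?thesis using iv[OF that] p2 by simp
    qed
    show "(\<lambda>i\<in>{0..d}. n i mod p) \<in> S"
      using ivm iv p2 unfolding v_def[symmetric] S_def by (auto simp: v_def PiE_iff)
  qed
  also have "\<dots> = box_sum d Y f"
    unfolding box_sum_def
    by (rule sum.mono_neutral_left) (auto simp: T_def intro!: zero finite_PiE)
  finally show ?thesis .
qed

text \<open>Restrict all \<open>d + 1\<close> coordinates to \<open>{0..<q}\<close>, where
  \<open>q\<close> is the ceiling of \<open>N / (d + 1)\<close>: since
  \<open>(d + 1) * (q - 1) \<le> N - 1\<close>, every vertex stays in
  \<open>{0..<N}\<close>.\<close>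

lemma box_sum_one_ge:
  assumes "N \<ge> 1"
  shows "Re (box_sum d (int N) (restrict_to_initial N (\<lambda>_. 1))) \<ge> (real N / real (d + 1)) ^ (d + 1)"
proof -
  define f where "f = restrict_to_initial N (\<lambda>_. 1)"
  define q where "q = (N - 1) div (d + 1) + 1"
  define P where "P n \<longleftrightarrow> (\<forall>\<omega>\<subseteq>{1..d}. ivert n \<omega> \<in> {0..<int N})" for n
  have terms: "cube_term d f (ivert n) = of_bool (P n)" for n
  proof (cases "P n")
    case True
    hence "cube_term d f (ivert n) = (\<Prod>\<omega>\<in>Pow {1..d}. 1)"
      unfolding cube_term_def by (intro prod.cong) (auto simp: P_def f_def restrict_to_initial_def)
    thus ?thesis using True by simp
  next
    case False
    then obtain \<omega> where "\<omega> \<subseteq> {1..d}" "f (ivert n \<omega>) = 0"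
      by (auto simp: P_def f_def restrict_to_initial_def)
    thus ?thesis using False cube_term_eq_0 by simp
  qed
  have fin: "finite ({0..d} \<rightarrow>\<^sub>E {-int N..<int N})" by (intro finite_PiE) auto
  have "box_sum d (int N) f = of_nat (card {n \<in> {0..d} \<rightarrow>\<^sub>E {-int N..<int N}. P n})"
    unfolding box_sum_def terms using fin by (simp add: sum.If_cases of_bool_def Int_def)
  hence eq: "Re (box_sum d (int N) f) = real (card {n \<in> {0..d} \<rightarrow>\<^sub>E {-int N..<int N}. P n})" by simp
  have qN: "(d + 1) * (q - 1) \<le> N - 1"
    unfolding q_def by (metis add_diff_cancel_right' mult_div_mod_eq le_add1)
  have "{0..d} \<rightarrow>\<^sub>E {0..<int q} \<subseteq> {n \<in> {0..d} \<rightarrow>\<^sub>E {-int N..<int N}. P n}"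
  proof
    fix n assume n: "n \<in> {0..d} \<rightarrow>\<^sub>E {0..<int q}"
    have nb: "0 \<le> n i" "n i \<le> int (q - 1)" if "i \<le> d" for i
      using n that by (force simp: PiE_iff)+
    have "(N - 1) div (d + 1) \<le> N - 1" by (rule div_le_dividend)
    hence "q \<le> N" unfolding q_def using assms by linarith
    hence "n \<in> {0..d} \<rightarrow>\<^sub>E {-int N..<int N}" using n by (force simp: PiE_iff)
    moreover have "P n" unfolding P_def
    proof (intro allI impI)
      fix \<omega> assume \<omega>: "\<omega> \<subseteq> {1..d}"
      have "ivert n \<omega> \<le> int (q - 1) + (\<Sum>i\<in>{1..d}. int (q - 1))"
        unfolding ivert_def
      proof (intro add_mono nb)
        have "(\<Sum>i\<in>\<omega>. n i) \<le> (\<Sum>i\<in>{1..d}. n i)" using \<omega> nb by (intro sum_mono2) auto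
        also have "\<dots> \<le> (\<Sum>i\<in>{1..d}. int (q - 1))" using nb by (intro sum_mono) auto
        finally show "(\<Sum>i\<in>\<omega>. n i) \<le> (\<Sum>i\<in>{1..d}. int (q - 1))" .
      qed simp
      also have "\<dots> = int ((d + 1) * (q - 1))"
        unfolding of_nat_mult by (simp add: algebra_simps)
      also have "\<dots> \<le> int (N - 1)" using qN by linarith
      finally have "ivert n \<omega> < int N" using assms by simp
      moreover have "ivert n \<omega> \<ge> 0" unfolding ivert_def
        using nb \<omega> by (intro add_nonneg_nonneg sum_nonneg) auto
      ultimately show "ivert n \<omega> \<in> {0..<int N}" by simp
    qed
    ultimately show "n \<in> {n \<in> {0..d} \<rightarrow>\<^sub>E {-int N..<int N}. P n}" by simp
  qed
  hence "card ({0..d} \<rightarrow>\<^sub>E {0..<int q}) \<le> card {n \<in> {0..d} \<rightarrow>\<^sub>E {-int N..<int N}. P n}"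
    using fin by (intro card_mono) auto
  also have "card ({0..d} \<rightarrow>\<^sub>E {0..<int q}) = q ^ (d + 1)"
    by (subst card_PiE) auto
  finally have le: "real q ^ (d + 1) \<le> Re (box_sum d (int N) f)"
    unfolding eq by (metis of_nat_le_iff of_nat_power)
  have "(d + 1) * q = (N - 1) div (d + 1) * (d + 1) + (d + 1)"
    by (simp only: q_def distrib_left mult.commute mult_1_right)
  moreover have "(N - 1) mod (d + 1) < d + 1" by (rule mod_less_divisor) simp
  ultimately have "N \<le> (d + 1) * q"
    using div_mult_mod_eq[of "N - 1" "d + 1"] by linarith
  hence "real N \<le> real (d + 1) * real q" by (metis of_nat_le_iff of_nat_mult)
  hence "real N / real (d + 1) \<le> real q" by (simp add: field_simps)
  hence "(real N / real (d + 1)) ^ (d + 1) \<le> real q ^ (d + 1)" by (intro power_mono) auto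
  thus ?thesis using le unfolding f_def by linarith
qed

lemma gowers_modulus_gt: "gowers_modulus d N > 2 * d * N"
proof -
  obtain p :: nat where "prime p" "p > 2 * d * N" using bigger_prime by blast
  hence "prime (gowers_modulus d N) \<and> gowers_modulus d N > 2 * d * N"
    unfolding gowers_modulus_def by (intro LeastI) auto
  thus ?thesis by simp
qed

text \<open>The factors \<open>p ^ (d + 1)\<close> cancel, leaving a root of a quotient of box sums,
  with denominator bounded below by \<open>box_sum_one_ge\<close>. Allowing \<open>Y\<close> beyond
  \<open>N\<close> permits a multiple of the block length.\<close>

lemma gowers_norm_initial_le:
  assumes d: "d \<ge> 1" and N: "N \<ge> 1" and Y: "Y \<ge> int N"
    and X: "cmod (box_sum d Y (restrict_to_initial N a)) \<le> X * real N ^ (d + 1)"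
  shows "gowers_norm_initial d N a \<le> root (2 ^ d) (X * real (d + 1) ^ (d + 1))"
proof -
  define p where "p = gowers_modulus d N"
  have p: "int p > 2 * int d * int N" 
    using gowers_modulus_gt[of d N] unfolding p_def by (metis of_nat_less_iff of_nat_mult of_nat_numeral)
  have p0: "p > 0" using gowers_modulus_gt[of d N] by (simp add: p_def)
  define S where "S b = box_sum d Y (restrict_to_initial N b)" for b
  have avg: "gowers_average d (integer_mod_group p) (restrict_to_initial N b) = S b / of_nat (p ^ (d + 1))" for b
    unfolding gowers_average_integer_mod[OF p0] S_def
    by (subst cube_no_wrap[OF d _ p Y]) (use N in \<open>auto simp: restrict_to_initial_def\<close>)
  \<comment> \<open>Both equal the same sum modulo \<open>p\<close>, whatever the admissible
    range.\<close>
  have "S (\<lambda>_. 1) = box_sum d (int N) (restrict_to_initial N (\<lambda>_. 1))"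
    unfolding S_def
    by (subst (1 2) cube_no_wrap[OF d _ p, symmetric]) (use N Y in \<open>auto simp: restrict_to_initial_def\<close>)
  hence one: "Re (S (\<lambda>_. 1)) \<ge> (real N / real (d + 1)) ^ (d + 1)"
    using box_sum_one_ge[OF N] by simp
  have pos: "(real N / real (d + 1)) ^ (d + 1) > 0" using N by simp
  have Re: "Re (z / of_nat (p ^ (d + 1))) = Re z / real (p ^ (d + 1))" for z
    by (rule Re_divide_of_nat)
  have "gowers_norm_initial d N a = root (2 ^ d) (Re (S a) / Re (S (\<lambda>_. 1)))"
    unfolding gowers_norm_initial_def gowers_norm_def p_def[symmetric] avg Re
    using p0 by (simp add: real_root_divide[symmetric])
  also have "\<dots> \<le> root (2 ^ d) (X * real (d + 1) ^ (d + 1))"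
  proof (subst real_root_le_iff)
    have "Re (S a) / Re (S (\<lambda>_. 1)) \<le> cmod (S a) / Re (S (\<lambda>_. 1))"
      using one pos complex_Re_le_cmod by (intro divide_right_mono) auto
    also have "\<dots> \<le> cmod (S a) / (real N / real (d + 1)) ^ (d + 1)"
      using one pos by (intro divide_left_mono mult_pos_pos) auto
    also have "\<dots> \<le> (X * real N ^ (d + 1)) / (real N / real (d + 1)) ^ (d + 1)"
      using X pos unfolding S_def by (intro divide_right_mono) auto
    also have "\<dots> = X * real (d + 1) ^ (d + 1)" using N by (simp add: power_divide)
    finally show "Re (S a) / Re (S (\<lambda>_. 1)) \<le> X * real (d + 1) ^ (d + 1)" .
  qed simp
  finally show ?thesis .
qed

section \<open>Decay of Gowers norms\<close>

text \<open>The vertex value and the coordinates \<open>m 1, ..., m d\<close> determine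
  \<open>m 0\<close>.\<close>

lemma card_ivert_eq:
  "card {m \<in> {0..d} \<rightarrow>\<^sub>E {-Y..<Y}. ivert m \<omega> = c} \<le> nat (2 * Y) ^ d" if "\<omega> \<subseteq> {1..d}"
proof -
  let ?A = "{m \<in> {0..d} \<rightarrow>\<^sub>E {-Y..<Y}. ivert m \<omega> = c}"
  have "inj_on (\<lambda>m. restrict m {1..d}) ?A"
  proof (rule inj_onI)
    fix m m' assume a: "m \<in> ?A" "m' \<in> ?A" and eq: "restrict m {1..d} = restrict m' {1..d}"
    have e: "m i = m' i" if "i \<in> {1..d}" for i using fun_cong[OF eq, of i] that by simp
    have "(\<Sum>i\<in>\<omega>. m i) = (\<Sum>i\<in>\<omega>. m' i)" using that e by (intro sum.cong) auto
    moreover have "ivert m \<omega> = ivert m' \<omega>" using a by simp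
    ultimately have "m 0 = m' 0" by (simp add: ivert_def)
    hence "m i = m' i" if "i \<le> d" for i using that e[of i] by (cases "i = 0") auto
    thus "m = m'" using a by (intro PiE_ext[of m "{0..d}" "\<lambda>_. {-Y..<Y}" m']) auto
  qed
  moreover have "(\<lambda>m. restrict m {1..d}) ` ?A \<subseteq> {1..d} \<rightarrow>\<^sub>E {-Y..<Y}"
    by (auto simp: PiE_iff)
  ultimately have "card ?A \<le> card ({1..d} \<rightarrow>\<^sub>E {-Y..<Y})"
    by (rule card_inj_on_le) (intro finite_PiE, auto)
  also have "\<dots> = nat (2 * Y) ^ d" by (subst card_PiE) auto
  finally show ?thesis .
qed

lemma card_ivert_boundary:
  assumes "finite S"
  shows "card {m \<in> {0..d} \<rightarrow>\<^sub>E {-Y..<Y}. \<exists>\<omega>\<subseteq>{1..d}. ivert m \<omega> \<in> S}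
    \<le> 2 ^ d * (card S * nat (2 * Y) ^ d)"
proof -
  have "{m \<in> {0..d} \<rightarrow>\<^sub>E {-Y..<Y}. \<exists>\<omega>\<subseteq>{1..d}. ivert m \<omega> \<in> S} =
      (\<Union>\<omega>\<in>Pow {1..d}. \<Union>c\<in>S. {m \<in> {0..d} \<rightarrow>\<^sub>E {-Y..<Y}. ivert m \<omega> = c})" by auto
  hence "card {m \<in> {0..d} \<rightarrow>\<^sub>E {-Y..<Y}. \<exists>\<omega>\<subseteq>{1..d}. ivert m \<omega> \<in> S} \<le>
      (\<Sum>\<omega>\<in>Pow {1..d}. card (\<Union>c\<in>S. {m \<in> {0..d} \<rightarrow>\<^sub>E {-Y..<Y}. ivert m \<omega> = c}))"
    by (simp only:) (rule card_UN_le, simp)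
  also have "\<dots> \<le> (\<Sum>\<omega>\<in>Pow {1..d}. \<Sum>c\<in>S. nat (2 * Y) ^ d)"
    by (intro sum_mono order_trans[OF card_UN_le[OF assms]] card_ivert_eq) auto
  also have "\<dots> = 2 ^ d * (card S * nat (2 * Y) ^ d)" by (simp add: card_Pow)
  finally show ?thesis .
qed

lemma ivert_split:
  "\<omega> \<subseteq> {1..d} \<Longrightarrow> ivert (\<lambda>i\<in>{0..d}. m i * M + int (x i)) \<omega> = ivert m \<omega> * M + int (x 0 + (\<Sum>i\<in>\<omega>. x i))"
proof -
  assume \<omega>: "\<omega> \<subseteq> {1..d}"
  have "(\<Sum>i\<in>\<omega>. (\<lambda>i\<in>{0..d}. m i * M + int (x i)) i) = (\<Sum>i\<in>\<omega>. m i * M + int (x i))"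
    using \<omega> by (intro sum.cong) auto
  also have "\<dots> = (\<Sum>i\<in>\<omega>. m i) * M + (\<Sum>i\<in>\<omega>. int (x i))" by (simp add: sum.distrib sum_distrib_right)
  finally show ?thesis unfolding ivert_def by (simp add: distrib_right)
qed

section \<open>Box sums cut into digit blocks\<close>

context idempotent_digit
begin

lemma box_sum_blocks:
  fixes M :: nat
  assumes "M > 0"
  shows "box_sum d (Y * int M) f = (\<Sum>m\<in>{0..d} \<rightarrow>\<^sub>E {-Y..<Y}. \<Sum>x\<in>{0..d} \<rightarrow>\<^sub>E {..<M}.
     cube_term d f (\<lambda>\<omega>. ivert m \<omega> * int M + int (vert x \<omega>)))"
proof -
  have "box_sum d (Y * int M) f = (\<Sum>x\<in>{0..d} \<rightarrow>\<^sub>E {..<M}. \<Sum>m\<in>{0..d} \<rightarrow>\<^sub>E {-Y..<Y}.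
     cube_term d f (ivert (\<lambda>i\<in>{0..d}. m i * int M + int (x i))))"
    unfolding box_sum_def
  proof (rule sum_PiE_split[where \<alpha> = "\<lambda>n. n div int M" and \<beta> = "\<lambda>n. nat (n mod int M)"])
    fix a :: int and b :: nat assume a: "a \<in> {-Y..<Y}" and b: "b \<in> {..<M}"
    have "-Y * int M \<le> a * int M" "(a + 1) * int M \<le> Y * int M"
      using a by (intro mult_right_mono; auto)+
    hence "-(Y * int M) \<le> a * int M + int b" "a * int M + int b < Y * int M"
      using b by (auto simp: algebra_simps)
    thus "a * int M + int b \<in> {-(Y * int M)..<Y * int M} \<and> (a * int M + int b) div int M = a \<and>
        nat ((a * int M + int b) mod int M) = b"
      using b assms by simp
  next
    fix c assume c: "c \<in> {-(Y * int M)..<Y * int M}"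
    have "c div int M \<ge> (-Y * int M) div int M" using c assms by (intro zdiv_mono1) auto
    moreover have "c div int M < Y"
    proof -
      have "c div int M * int M \<le> c" using pos_mod_sign[of "int M" c] assms
        by (simp flip: minus_mod_eq_div_mult)
      hence "c div int M * int M < Y * int M" using c by auto
      thus ?thesis using assms by simp
    qed
    moreover have "(-Y * int M) div int M = -Y" using assms by (intro nonzero_mult_div_cancel_right) simp
    ultimately have "c div int M \<in> {-Y..<Y}" by simp
    moreover have "nat (c mod int M) \<in> {..<M}" using assms by (simp add: nat_less_iff)
    ultimately show "c div int M \<in> {-Y..<Y} \<and> nat (c mod int M) \<in> {..<M} \<and>
        c div int M * int M + int (nat (c mod int M)) = c"
      using assms by simp
  qed
  also have "\<dots> = (\<Sum>m\<in>{0..d} \<rightarrow>\<^sub>E {-Y..<Y}. \<Sum>x\<in>{0..d} \<rightarrow>\<^sub>E {..<M}.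
     cube_term d f (ivert (\<lambda>i\<in>{0..d}. m i * int M + int (x i))))" by (rule sum.swap)
  also have "\<dots> = (\<Sum>m\<in>{0..d} \<rightarrow>\<^sub>E {-Y..<Y}. \<Sum>x\<in>{0..d} \<rightarrow>\<^sub>E {..<M}.
     cube_term d f (\<lambda>\<omega>. ivert m \<omega> * int M + int (vert x \<omega>)))"
    unfolding cube_term_def
    by (intro sum.cong refl prod.cong) (simp add: ivert_split vert_def)
  finally show ?thesis .
qed

text \<open>Inner vertices stay below \<open>(d + 1) * W ^ t\<close>, and the hypothesis leaves that
  much room; so the cut-off is inactive, and \<open>rr_append\<close> turns the overflow into a
  carry.\<close>

lemma block_inside:
  assumes m: "\<And>\<omega>. \<omega> \<subseteq> {1..d} \<Longrightarrow> 0 \<le> ivert m \<omega> \<and> (ivert m \<omega> + int (d + 1)) * int (W ^ t) \<le> int Nn"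
  shows "(\<Sum>x\<in>box d t. cube_term d (restrict_to_initial Nn (\<lambda>n. F (rr n)))
      (\<lambda>\<omega>. ivert m \<omega> * int (W ^ t) + int (vert x \<omega>))) =
    cube_sum d t (\<lambda>_. 0) (\<lambda>\<omega> c. rr (nat (ivert m \<omega>) + c))
      (\<lambda>\<sigma>. \<Prod>\<omega>\<in>Pow {1..d}. (cnj ^^ card \<omega>) (F (\<sigma> \<omega>)))"
  unfolding cube_sum_def cube_term_def
proof (intro sum.cong refl prod.cong arg_cong[where f = "cnj ^^ _"])
  fix x \<omega> assume x: "x \<in> box d t" and \<omega>: "\<omega> \<in> Pow {1..d}"
  define p where "p = nat (ivert m \<omega>)"
  have p: "ivert m \<omega> = int p" using m \<omega> by (simp add: p_def)
  have "(p + (d + 1)) * W ^ t \<le> Nn"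
  proof -
    have "int ((p + (d + 1)) * W ^ t) \<le> int Nn"
      using m[of \<omega>] \<omega> unfolding p of_nat_mult of_nat_add[of p] by blast
    thus ?thesis by linarith
  qed
  moreover have "vert x \<omega> < (d + 1) * W ^ t"
  proof -
    have "vert x \<omega> div W ^ t \<le> d" using carry_bound[OF x, of \<omega> 0] \<omega> by simp
    thus ?thesis using W by (simp add: less_Suc_eq_le[symmetric] div_less_iff_less_mult)
  qed
  ultimately have lt: "p * W ^ t + vert x \<omega> < Nn" by (simp add: distrib_right)
  have "ivert m \<omega> * int (W ^ t) + int (vert x \<omega>) = int (p * W ^ t + vert x \<omega>)" by (simp add: p)
  hence "restrict_to_initial Nn (\<lambda>n. F (rr n)) (ivert m \<omega> * int (W ^ t) + int (vert x \<omega>)) =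
      F (rr (p * W ^ t + vert x \<omega>))"
    using lt unfolding restrict_to_initial_def by (simp del: of_nat_add of_nat_mult of_nat_power)
  also have "\<dots> = F (act t (vert x \<omega>) * rr (p + vert x \<omega> div W ^ t))"
    by (simp add: rr_append)
  finally show "restrict_to_initial Nn (\<lambda>n. F (rr n)) (ivert m \<omega> * int (W ^ t) + int (vert x \<omega>)) =
      F ((\<lambda>\<omega>\<in>Pow {1..d}. act t (vert x \<omega> + 0) *
        rr (nat (ivert m \<omega>) + (vert x \<omega> + 0) div W ^ t)) \<omega>)"
    using \<omega> by (simp add: p)
qed

text \<open>Only the factor at the top vertex depends on \<open>h\<close>, and conjugation is
  additive.\<close>

lemma mean_zero_prod:
  assumes "\<And>r. (\<Sum>h\<in>N. F (r * h)) = 0"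
  shows "mean_zero d (\<lambda>\<sigma>. \<Prod>\<omega>\<in>Pow {1..d}. (cnj ^^ card \<omega>) (F (\<sigma> \<omega>)))"
  unfolding mean_zero_def
proof
  fix \<sigma>
  define D where "D = {1..d}"
  define P where "P = (\<Prod>\<omega>\<in>Pow D - {D}. (cnj ^^ card \<omega>) (F (\<sigma> \<omega>)))"
  have "(\<Prod>\<omega>\<in>Pow D. (cnj ^^ card \<omega>) (F ((\<sigma>(D := \<sigma> D * h)) \<omega>))) =
      (cnj ^^ card D) (F (\<sigma> D * h)) * P" for h
  proof -
    have "(\<Prod>\<omega>\<in>Pow D. (cnj ^^ card \<omega>) (F ((\<sigma>(D := \<sigma> D * h)) \<omega>))) =
        (cnj ^^ card D) (F ((\<sigma>(D := \<sigma> D * h)) D)) *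
        (\<Prod>\<omega>\<in>Pow D - {D}. (cnj ^^ card \<omega>) (F ((\<sigma>(D := \<sigma> D * h)) \<omega>)))"
      by (rule prod.remove) (auto simp: D_def)
    also have "(\<Prod>\<omega>\<in>Pow D - {D}. (cnj ^^ card \<omega>) (F ((\<sigma>(D := \<sigma> D * h)) \<omega>))) = P"
      unfolding P_def by (rule prod.cong) auto
    finally show ?thesis by simp
  qed
  hence "(\<Sum>h\<in>N. \<Prod>\<omega>\<in>Pow D. (cnj ^^ card \<omega>) (F ((\<sigma>(D := \<sigma> D * h)) \<omega>))) =
      (cnj ^^ card D) (\<Sum>h\<in>N. F (\<sigma> D * h)) * P"
    by (simp add: sum_distrib_right funpow_cnj_sum)
  thus "(\<Sum>h\<in>N. \<Prod>\<omega>\<in>Pow {1..d}. (cnj ^^ card \<omega>) (F ((\<sigma>({1..d} := \<sigma> {1..d} * h)) \<omega>))) = 0"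
    using assms by (simp add: D_def)
qed

text \<open>
  Blocks whose vertices all stay inside \<open>{0..<Nn}\<close> are controlled by the contraction, blocks with a
  vertex outside contribute nothing, and the second summand bounds the remaining boundary blocks.
\<close>

lemma box_sum_le:
  assumes mz: "\<And>r. (\<Sum>h\<in>N. F (r * h)) = 0" and B: "\<And>r. cmod (F r) \<le> B"
  obtains s where "s > 0"
    "\<And>j Nn. W ^ (s * j) \<le> Nn \<Longrightarrow>
      cmod (box_sum d (int (Nn div W ^ (s * j) + 1) * int (W ^ (s * j)))
        (restrict_to_initial Nn (\<lambda>n. F (rr n))))
      \<le> B ^ 2 ^ d * (real (2 * (Nn div W ^ (s * j) + 1)) ^ (d + 1) * real ((W ^ s) ^ Suc d - 1) ^ j +
         2 ^ d * real (2 * d + 1) * real (2 * (Nn div W ^ (s * j) + 1)) ^ d * real (W ^ (s * j)) ^ (d + 1))"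
proof -
  obtain s where s: "s > 0" and decay: "\<And>j r \<rho> \<Psi> B. (\<forall>\<omega>\<subseteq>{1..d}. r \<omega> \<le> d) \<Longrightarrow> (\<forall>c. \<rho> {1..d} c \<in> R) \<Longrightarrow>
     mean_zero d \<Psi> \<Longrightarrow> (\<forall>\<sigma>. cmod (\<Psi> \<sigma>) \<le> B) \<Longrightarrow>
     cmod (cube_sum d (s * j) r \<rho> \<Psi>) \<le> B * real ((W ^ s) ^ Suc d - 1) ^ j"
    using cube_sum_decay[of d] by metis
  have B0: "B \<ge> 0" using B norm_ge_zero order_trans by blast
  have "cmod (box_sum d (int (Nn div W ^ (s * j) + 1) * int (W ^ (s * j)))
        (restrict_to_initial Nn (\<lambda>n. F (rr n))))
      \<le> B ^ 2 ^ d * (real (2 * (Nn div W ^ (s * j) + 1)) ^ (d + 1) * real ((W ^ s) ^ Suc d - 1) ^ j +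
         2 ^ d * real (2 * d + 1) * real (2 * (Nn div W ^ (s * j) + 1)) ^ d * real (W ^ (s * j)) ^ (d + 1))"
    for j Nn
  proof -
    define M where "M = W ^ (s * j)"
    define Y where "Y = Nn div M + 1"
    define f where "f = restrict_to_initial Nn (\<lambda>n. F (rr n))"
    have M: "M > 0" using W by (simp add: M_def)
    define g where "g m = (\<Sum>x\<in>box d (s * j). cube_term d f (\<lambda>\<omega>. ivert m \<omega> * int M + int (vert x \<omega>)))" for m
    \<comment> \<open>The at most \<open>2 * d + 1\<close> values of \<open>ivert m \<omega>\<close>
      for which the \<open>d + 1\<close> consecutive blocks starting there may cross
      \<open>0\<close> or \<open>Nn\<close>.\<close>
    define S where "S = {- int d..-1} \<union> {int (Nn div M) - int d..int (Nn div M)}"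
    define A where "A = {0..d} \<rightarrow>\<^sub>E {-int Y..<int Y}"
    define A1 where "A1 = {m \<in> A. \<exists>\<omega>\<subseteq>{1..d}. ivert m \<omega> \<in> S}"
    have finA: "finite A" unfolding A_def by (intro finite_PiE) auto
    have cardA: "card A = (2 * Y) ^ (d + 1)"
    proof -
      have "card A = nat (2 * int Y) ^ (d + 1)" unfolding A_def by (subst card_PiE) auto
      also have "nat (2 * int Y) = 2 * Y" by simp
      finally show ?thesis .
    qed
    have fB: "cmod (f x) \<le> B" for x using B B0 by (simp add: f_def restrict_to_initial_def)
    have "card S \<le> card {- int d..-1} + card {int (Nn div M) - int d..int (Nn div M)}"
      unfolding S_def by (rule card_Un_le)
    hence cardS: "card S \<le> 2 * d + 1" by simp
    have "card A1 \<le> 2 ^ d * (card S * nat (2 * int Y) ^ d)"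
      unfolding A1_def A_def by (rule card_ivert_boundary) (simp add: S_def)
    also have "nat (2 * int Y) = 2 * Y" by simp
    also have "2 ^ d * (card S * (2 * Y) ^ d) \<le> 2 ^ d * ((2 * d + 1) * (2 * Y) ^ d)"
      using cardS by (intro mult_left_mono mult_mono) auto
    finally have "real (card A1) \<le> real (2 ^ d * ((2 * d + 1) * (2 * Y) ^ d))" by linarith
    hence cardA1: "real (card A1) \<le> 2 ^ d * real (2 * d + 1) * real (2 * Y) ^ d"
      by (simp only: of_nat_mult of_nat_power of_nat_numeral mult.assoc)
    have vlt: "vert x \<omega> < (d + 1) * M" if "x \<in> box d (s * j)" "\<omega> \<subseteq> {1..d}" for x \<omega>
    proof -
      have "vert x \<omega> div M \<le> d" using carry_bound[OF that, of 0] by (simp add: M_def)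
      thus ?thesis using M by (simp add: less_Suc_eq_le[symmetric] div_less_iff_less_mult)
    qed
    have g1: "cmod (g m) \<le> real M ^ (d + 1) * B ^ 2 ^ d" for m
    proof -
      have "cmod (g m) \<le> (\<Sum>x\<in>box d (s * j). B ^ 2 ^ d)"
        unfolding g_def by (intro sum_norm_le cube_term_bound fB)
      thus ?thesis by (simp add: card_box M_def)
    qed
    have g2: "cmod (g m) \<le> B ^ 2 ^ d * real ((W ^ s) ^ Suc d - 1) ^ j" if m: "m \<in> A - A1" for m
    proof (cases "\<forall>\<omega>\<subseteq>{1..d}. 0 \<le> ivert m \<omega> \<and> (ivert m \<omega> + int (d + 1)) * int M \<le> int Nn")
      case True
      have "g m = cube_sum d (s * j) (\<lambda>_. 0) (\<lambda>\<omega> c. rr (nat (ivert m \<omega>) + c))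
         (\<lambda>\<sigma>. \<Prod>\<omega>\<in>Pow {1..d}. (cnj ^^ card \<omega>) (F (\<sigma> \<omega>)))"
        unfolding g_def f_def M_def by (rule block_inside) (use True in \<open>simp add: M_def\<close>)
      also have "cmod \<dots> \<le> B ^ 2 ^ d * real ((W ^ s) ^ Suc d - 1) ^ j"
      proof (rule decay)
        show "\<forall>\<sigma>. cmod (\<Prod>\<omega>\<in>Pow {1..d}. (cnj ^^ card \<omega>) (F (\<sigma> \<omega>))) \<le> B ^ 2 ^ d"
        proof
          fix \<sigma> :: "nat set \<Rightarrow> 'm"
          have "cmod (\<Prod>\<omega>\<in>Pow {1..d}. (cnj ^^ card \<omega>) (F (\<sigma> \<omega>))) \<le> (\<Prod>\<omega>\<in>Pow {1..d}. B)"
            unfolding prod_norm[symmetric] by (rule prod_mono) (use B in auto)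
          thus "cmod (\<Prod>\<omega>\<in>Pow {1..d}. (cnj ^^ card \<omega>) (F (\<sigma> \<omega>))) \<le> B ^ 2 ^ d"
            by (simp add: card_Pow)
        qed
      qed (use mean_zero_prod[of F d] mz rr_R in auto)
      finally show ?thesis .
    next
      case False
      then obtain \<omega> where \<omega>: "\<omega> \<subseteq> {1..d}"
        and neg: "\<not> (0 \<le> ivert m \<omega> \<and> (ivert m \<omega> + int (d + 1)) * int M \<le> int Nn)" by blast
      have nS: "ivert m \<omega> \<notin> S" using m \<omega> by (auto simp: A1_def)
      define p where "p = ivert m \<omega>"
      have "p \<le> - int (d + 1) \<or> p > int (Nn div M)"
      proof (rule ccontr)
        assume c: "\<not> ?thesis"
        hence "p \<ge> 0" "p + int (d + 1) \<le> int (Nn div M)" using nS by (auto simp: S_def p_def)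
        moreover have "int (Nn div M) * int M \<le> int Nn"
          by (metis div_times_less_eq_dividend of_nat_le_iff of_nat_mult)
        moreover have "(p + int (d + 1)) * int M \<le> int (Nn div M) * int M"
          using calculation by (intro mult_right_mono) auto
        ultimately show False using neg by (simp add: p_def)
      qed
      hence out: "p * int M + int (vert x \<omega>) \<notin> {0..<int Nn}" if "x \<in> box d (s * j)" for x
      proof
        assume "p \<le> - int (d + 1)"
        hence "p * int M \<le> - int (d + 1) * int M" by (intro mult_right_mono) auto
        moreover have "int (vert x \<omega>) < int ((d + 1) * M)" using vlt[OF that \<omega>] by linarith
        ultimately have "p * int M + int (vert x \<omega>) < 0" by (simp add: algebra_simps)
        thus ?thesis by simp
      next
        assume "p > int (Nn div M)"
        hence "(int (Nn div M) + 1) * int M \<le> p * int M" by (intro mult_right_mono) auto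
        moreover have "Nn < (Nn div M + 1) * M" using M by (simp add: dividend_less_div_times)
        hence "int Nn < (int (Nn div M) + 1) * int M"
          by (metis of_nat_1 of_nat_add of_nat_less_iff of_nat_mult)
        ultimately show ?thesis by simp
      qed
      have "g m = 0" unfolding g_def
        by (intro sum.neutral ballI cube_term_eq_0[OF \<omega>])
           (use out in \<open>auto simp: f_def restrict_to_initial_def p_def\<close>)
      thus ?thesis using B0 by simp
    qed
    have "box_sum d (int Y * int M) f = (\<Sum>m\<in>A. g m)"
      unfolding A_def g_def M_def by (rule box_sum_blocks) (use W in simp)
    also have "\<dots> = (\<Sum>m\<in>A - A1. g m) + (\<Sum>m\<in>A1. g m)"
      by (rule sum.subset_diff) (use finA in \<open>auto simp: A1_def\<close>)
    finally have "cmod (box_sum d (int Y * int M) f) \<le> cmod (\<Sum>m\<in>A - A1. g m) + cmod (\<Sum>m\<in>A1. g m)"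
      by (simp add: norm_triangle_ineq)
    also have "\<dots> \<le> (\<Sum>m\<in>A - A1. B ^ 2 ^ d * real ((W ^ s) ^ Suc d - 1) ^ j) + (\<Sum>m\<in>A1. real M ^ (d + 1) * B ^ 2 ^ d)"
      by (intro add_mono sum_norm_le g1 g2)
    also have "\<dots> \<le> real (card A) * (B ^ 2 ^ d * real ((W ^ s) ^ Suc d - 1) ^ j)
        + (2 ^ d * real (2 * d + 1) * real (2 * Y) ^ d) * (real M ^ (d + 1) * B ^ 2 ^ d)"
    proof -
      have "real (card (A - A1)) \<le> real (card A)" using finA by (simp add: card_mono)
      thus ?thesis using cardA1 B0 by (auto intro!: add_mono mult_right_mono simp del: power_Suc of_nat_mult)
    qed
    also have "\<dots> = B ^ 2 ^ d * (real (2 * Y) ^ (d + 1) * real ((W ^ s) ^ Suc d - 1) ^ j +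
         2 ^ d * real (2 * d + 1) * real (2 * Y) ^ d * real M ^ (d + 1))"
      unfolding cardA of_nat_power by (simp only: algebra_simps)
    finally show ?thesis unfolding M_def Y_def f_def .
  qed
  thus ?thesis using s that by blast
qed

text \<open>In \<open>box_sum_le\<close> the main term saves one constant factor per digit block,
  and the boundary term saves about \<open>M / Nn\<close> for blocks of length \<open>M\<close>.
  With \<open>M\<close> of the order of the square root of \<open>Nn\<close>, both save a power of
  \<open>Nn\<close>.\<close>

lemma highly_gowers_uniform_mean_zero:
  assumes mz: "\<And>r. (\<Sum>h\<in>N. F (r * h)) = 0" and B: "\<And>r. cmod (F r) \<le> B"
  shows "highly_gowers_uniform (\<lambda>n. F (rr n))"
  unfolding highly_gowers_uniform_def
proof (rule conjI)
  show "\<exists>B. \<forall>n. cmod (F (rr n)) \<le> B" using B by blast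
  show "\<forall>d\<ge>1. \<exists>c>0. \<exists>C. \<forall>Nn\<ge>1. gowers_norm_initial d Nn (\<lambda>n. F (rr n)) \<le> C * real Nn powr - c"
  proof (intro allI impI)
    fix d :: nat assume d: "1 \<le> d"
    obtain s where s: "s > 0"
      and bound: "\<And>j Nn. W ^ (s * j) \<le> Nn \<Longrightarrow>
        cmod (box_sum d (int (Nn div W ^ (s * j) + 1) * int (W ^ (s * j)))
          (restrict_to_initial Nn (\<lambda>n. F (rr n))))
        \<le> B ^ 2 ^ d * (real (2 * (Nn div W ^ (s * j) + 1)) ^ (d + 1) * real ((W ^ s) ^ Suc d - 1) ^ j +
           2 ^ d * real (2 * d + 1) * real (2 * (Nn div W ^ (s * j) + 1)) ^ d * real (W ^ (s * j)) ^ (d + 1))"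
      by (rule box_sum_le[OF mz B, of d]) (rule that)
    have B0: "B \<ge> 0" using B norm_ge_zero order_trans by blast
    define Q where "Q = (W ^ s) ^ Suc d"
    \<comment> \<open>The square of \<open>W ^ s\<close>, so that \<open>U ^ j = M * M\<close> for
      the block length \<open>M = W ^ (s * j)\<close>.\<close>
    define U where "U = W ^ (2 * s)"
    have U: "U \<ge> 2" unfolding U_def
      using W s by (metis dual_order.trans less_W_power mult_pos_pos pos2 self_le_power W0 Suc_leI One_nat_def)
    have Q: "Q \<ge> 2"
    proof -
      have "W ^ 1 \<le> W ^ (s * Suc d)" using s W by (intro power_increasing) auto
      hence "W \<le> Q" unfolding Q_def power_mult by simp
      thus ?thesis using W by simp
    qed
    define \<theta> where "\<theta> = real (Q - 1) / real Q"
    have \<theta>: "0 < \<theta>" "\<theta> < 1" using Q by (auto simp: \<theta>_def)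
    have lnU: "ln (real U) > 0" using U by simp
    \<comment> \<open>Chosen so that \<open>\<theta> = U powr - \<eta>\<close>.\<close>
    define \<eta> where "\<eta> = - ln \<theta> / ln (real U)"
    have \<eta>: "\<eta> > 0" using \<theta> lnU by (simp add: \<eta>_def divide_neg_pos)
    \<comment> \<open>The bound \<open>1 / 2\<close> comes from the boundary term.\<close>
    define \<kappa> where "\<kappa> = min \<eta> (1 / 2)"
    have \<kappa>: "\<kappa> > 0" "\<kappa> \<le> \<eta>" "\<kappa> \<le> 1 / 2" using \<eta> by (auto simp: \<kappa>_def)
    define C0 where "C0 = 2 ^ d * real (2 * d + 1)"
    define C1 where "C1 = B ^ 2 ^ d * 4 ^ (d + 1) * (1 / \<theta> + C0)"
    define C2 where "C2 = C1 * real (d + 1) ^ (d + 1)"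
    have C0: "C0 \<ge> 0" by (simp add: C0_def)
    have C1: "C1 \<ge> 0" using B0 \<theta> C0 by (simp add: C1_def)
    have main: "gowers_norm_initial d Nn (\<lambda>n. F (rr n)) \<le> root (2 ^ d) C2 * real Nn powr - (\<kappa> / 2 ^ d)"
      if Nn: "Nn \<ge> 1" for Nn
    proof -
      obtain j where j: "U ^ j \<le> Nn" "Nn < U ^ (j + 1)" using ex_power_ivl1[OF U Nn] by blast
      define M where "M = W ^ (s * j)"
      define Y where "Y = Nn div M + 1"
      have M: "M \<ge> 1" using W by (simp add: M_def)
      have "U ^ j = M * M"
        by (simp add: M_def U_def mult_2 power_add flip: power_mult) (simp add: power_mult power_mult_distrib)
      hence MM: "M * M \<le> Nn" using j(1) by simp
      have "M \<le> M * M" using M by simp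
      hence MN: "M \<le> Nn" using MM by (rule order_trans)
      have x: "real Nn > 0" using Nn by simp
      have YM: "real (2 * Y) * real M \<le> 4 * real Nn"
      proof -
        have "Y * M \<le> Nn + M" by (simp add: Y_def)
        hence "2 * (Y * M) \<le> 4 * Nn" using MN by linarith
        hence "2 * Y * M \<le> 4 * Nn" by (simp only: mult.assoc)
        thus ?thesis by (metis of_nat_le_iff of_nat_mult of_nat_numeral)
      qed
      have QM: "real (Q - 1) ^ j = \<theta> ^ j * real M ^ (d + 1)"
      proof -
        have "Q ^ j = M ^ (d + 1)" by (simp add: Q_def M_def algebra_simps flip: power_mult power_add)
        hence "real Q ^ j = real M ^ (d + 1)" by (metis of_nat_power)
        thus ?thesis using Q M by (simp add: \<theta>_def power_divide)
      qed
      \<comment> \<open>Since \<open>Nn < U ^ (j + 1)\<close> controls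
        \<open>\<theta> ^ (j + 1)\<close>, the factor \<open>1 / \<theta>\<close> pays for the extra
        step.\<close>
      have th: "\<theta> ^ j \<le> 1 / \<theta> * real Nn powr - \<kappa>"
      proof -
        have "ln (real Nn) \<le> real (j + 1) * ln (real U)"
        proof -
          have "real Nn \<le> real U ^ (j + 1)" using j(2) by (metis less_imp_le of_nat_le_iff of_nat_power)
          hence "ln (real Nn) \<le> ln (real U ^ (j + 1))" using x by (intro ln_mono) auto
          also have "\<dots> = real (j + 1) * ln (real U)" by (rule ln_realpow)
          finally show ?thesis .
        qed
        hence "\<eta> * ln (real Nn) \<le> \<eta> * (real (j + 1) * ln (real U))" using \<eta> by (intro mult_left_mono) auto
        also have "\<dots> = - (real (j + 1) * ln \<theta>)" using lnU by (simp add: \<eta>_def)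
        finally have "real (j + 1) * ln \<theta> \<le> - \<eta> * ln (real Nn)" by simp
        hence "exp (real (j + 1) * ln \<theta>) \<le> exp (- \<eta> * ln (real Nn))" by (simp only: exp_le_cancel_iff)
        moreover have "exp (real (j + 1) * ln \<theta>) = \<theta> ^ (j + 1)"
          using \<theta> by (simp only: exp_of_nat_mult exp_ln)
        ultimately have "\<theta> ^ (j + 1) \<le> real Nn powr - \<eta>"
          using x by (simp only: powr_def of_nat_eq_0_iff) simp
        also have "\<dots> \<le> real Nn powr - \<kappa>" using Nn \<kappa> by (intro powr_mono) auto
        finally show ?thesis using \<theta> by (simp add: field_simps)
      qed
      have Mh: "real M \<le> real Nn * real Nn powr - \<kappa>"
      proof -
        have "real M * real M \<le> real Nn" using MM by (metis of_nat_le_iff of_nat_mult)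
        hence "real M \<le> sqrt (real Nn)" by (intro real_le_rsqrt) (simp add: power2_eq_square)
        also have "\<dots> = real Nn powr (1 + - (1 / 2))" using x by (simp add: powr_half_sqrt)
        also have "\<dots> \<le> real Nn powr (1 + - \<kappa>)" using Nn \<kappa> by (intro powr_mono) auto
        also have "\<dots> = real Nn * real Nn powr - \<kappa>" using x by (subst powr_add) simp
        finally show ?thesis .
      qed
      have "cmod (box_sum d (int Y * int M) (restrict_to_initial Nn (\<lambda>n. F (rr n))))
          \<le> B ^ 2 ^ d * (real (2 * Y) ^ (d + 1) * real (Q - 1) ^ j + C0 * real (2 * Y) ^ d * real M ^ (d + 1))"
        using bound[of j Nn] MN unfolding Y_def M_def Q_def C0_def by blast
      also have "\<dots> = B ^ 2 ^ d * ((real (2 * Y) * real M) ^ (d + 1) * \<theta> ^ j + C0 * (real (2 * Y) * real M) ^ d * real M)"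
        unfolding QM by (simp add: power_mult_distrib algebra_simps)
      also have "\<dots> \<le> B ^ 2 ^ d * ((4 * real Nn) ^ (d + 1) * (1 / \<theta> * real Nn powr - \<kappa>)
          + C0 * (4 * real Nn) ^ d * (real Nn * real Nn powr - \<kappa>))"
      proof (intro mult_left_mono add_mono mult_mono)
        show "(real (2 * Y) * real M) ^ n \<le> (4 * real Nn) ^ n" for n
          by (rule power_mono[OF YM]) simp
        thus "(real (2 * Y) * real M) ^ d \<le> (4 * real Nn) ^ d" .
      qed (use B0 C0 \<theta> th Mh in \<open>simp_all del: power_Suc\<close>)
      also have "\<dots> = B ^ 2 ^ d * (4 ^ (d + 1) * (1 / \<theta>) + C0 * 4 ^ d) * real Nn powr - \<kappa> * real Nn ^ (d + 1)"
        by (simp add: power_mult_distrib algebra_simps)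
      also have "\<dots> \<le> C1 * real Nn powr - \<kappa> * real Nn ^ (d + 1)"
      proof (intro mult_right_mono)
        have "C0 * 4 ^ d \<le> C0 * 4 ^ (d + 1)" using C0 by (intro mult_left_mono power_increasing) auto
        hence "4 ^ (d + 1) * (1 / \<theta>) + C0 * 4 ^ d \<le> 4 ^ (d + 1) * (1 / \<theta> + C0)"
          by (simp add: algebra_simps)
        thus "B ^ 2 ^ d * (4 ^ (d + 1) * (1 / \<theta>) + C0 * 4 ^ d) \<le> C1"
          unfolding C1_def mult.assoc using B0 by (intro mult_left_mono) auto
      qed auto
      finally have "cmod (box_sum d (int Y * int M) (restrict_to_initial Nn (\<lambda>n. F (rr n))))
          \<le> C1 * real Nn powr - \<kappa> * real Nn ^ (d + 1)" .
      moreover have "int Y * int M \<ge> int Nn"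
      proof -
        have "Nn < (Nn div M + 1) * M" using M by (simp add: dividend_less_div_times)
        thus ?thesis unfolding Y_def by (metis less_imp_le of_nat_le_iff of_nat_mult)
      qed
      ultimately have "gowers_norm_initial d Nn (\<lambda>n. F (rr n)) \<le>
          root (2 ^ d) (C1 * real Nn powr - \<kappa> * real (d + 1) ^ (d + 1))"
        by (intro gowers_norm_initial_le[OF d Nn])
      also have "C1 * real Nn powr - \<kappa> * real (d + 1) ^ (d + 1) = C2 * real Nn powr - \<kappa>"
        by (simp only: C2_def mult_ac)
      also have "root (2 ^ d) (C2 * real Nn powr - \<kappa>) = root (2 ^ d) C2 * root (2 ^ d) (real Nn powr - \<kappa>)"
        by (rule real_root_mult)
      also have "root (2 ^ d) (real Nn powr - \<kappa>) = real Nn powr - (\<kappa> / 2 ^ d)"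
        using x by (subst root_powr_inverse) (auto simp: powr_powr)
      finally show ?thesis .
    qed
    show "\<exists>c>0. \<exists>C. \<forall>Nn\<ge>1. gowers_norm_initial d Nn (\<lambda>n. F (rr n)) \<le> C * real Nn powr - c"
      using main \<kappa> by (intro exI[of _ "\<kappa> / 2 ^ d"] conjI exI[of _ "root (2 ^ d) C2"]) auto
  qed
qed

lemma structured_uniform_decomposition:
  assumes B: "\<And>r. cmod (F r) \<le> B"
  shows "\<exists>a_str a_uni. (\<forall>n. F (rr n) = a_str n + a_uni n) \<and>
    rationally_almost_periodic a_str \<and> highly_gowers_uniform a_uni"
proof (intro exI conjI)
  show "rationally_almost_periodic (\<lambda>n. coset_avg F (rr n))"
    by (rule rationally_almost_periodic_coset_avg)
  show "highly_gowers_uniform (\<lambda>n. (\<lambda>r. F r - coset_avg F r) (rr n))"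
  proof (rule highly_gowers_uniform_mean_zero)
    show "cmod (F r - coset_avg F r) \<le> B + B" for r
      using B coset_avg_bounded[OF B] by (intro norm_triangle_le_diff add_mono) auto
  qed (rule sum_N_minus_avg)
qed simp

end

section \<open>The transition monoid of an automaton\<close>

text \<open>A type copy of the self-maps of \<open>'s\<close>, to make composition an instance of \<^class>\<open>monoid_mult\<close>.\<close>

typedef 's endo = "UNIV :: ('s \<Rightarrow> 's) set" morphisms endo_app Endo ..

instantiation endo :: (type) monoid_mult
begin

definition one_endo :: "'a endo" where "1 = Endo id"

definition times_endo :: "'a endo \<Rightarrow> 'a endo \<Rightarrow> 'a endo" where
  "f * g = Endo (endo_app f \<circ> endo_app g)"

instance
  by standard (simp_all add: one_endo_def times_endo_def Endo_inverse endo_app_inverse o_assoc)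

end

lemma endo_app_one [simp]: "endo_app 1 s = s"
  by (simp add: one_endo_def Endo_inverse)

lemma endo_app_times [simp]: "endo_app (f * g) s = endo_app f (endo_app g s)"
  by (simp add: times_endo_def Endo_inverse)

lemma endo_eqI: "(\<And>s. endo_app f s = endo_app g s) \<Longrightarrow> f = g"
  by (metis endo_app_inverse ext)

text \<open>The pigeonhole principle gives \<open>x ^ a = x ^ (a + p)\<close> with
  \<open>a, p > 0\<close>. The exponent \<open>p * a\<close> is at least \<open>a\<close> and a
  multiple of the period, so doubling it changes nothing.\<close>

lemma finite_powers_idempotent_power:
  fixes x :: "'m::monoid_mult"
  assumes "finite X" "\<And>n. x ^ Suc n \<in> X"
  obtains m where "m > 0" "x ^ m * x ^ m = x ^ m"
proof -
  have "\<not> inj (\<lambda>n. x ^ Suc n)"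
    using assms by (metis finite_subset image_subset_iff infinite_UNIV_nat finite_imageD UNIV_I)
  then obtain i j where ij: "i < j" "x ^ Suc i = x ^ Suc j"
    unfolding inj_def by (metis nat_neq_iff)
  define a where "a = Suc i"
  define p where "p = j - i"
  have p: "p > 0" using ij by (simp add: p_def)
  have per: "x ^ (n + p) = x ^ n" if "n \<ge> a" for n
  proof -
    have "x ^ (n + p) = x ^ (n - a) * x ^ Suc j"
      unfolding power_add[symmetric] by (rule arg_cong[of _ _ "power x"]) (use that ij in \<open>simp add: a_def p_def\<close>)
    also have "\<dots> = x ^ (n - a) * x ^ a" using ij(2) by (simp only: a_def)
    also have "\<dots> = x ^ n" unfolding power_add[symmetric] using that by simp
    finally show ?thesis .
  qed
  have per': "x ^ (n + p * l) = x ^ n" if "n \<ge> a" for n l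
  proof (induction l)
    case (Suc l)
    have "n + p * Suc l = (n + p * l) + p" by simp
    moreover have "x ^ ((n + p * l) + p) = x ^ (n + p * l)" by (rule per) (use that in simp)
    ultimately show ?case using Suc by (simp only:)
  qed simp
  have "p * a \<ge> a" using p by simp
  hence "x ^ (p * a + p * a) = x ^ (p * a)" by (rule per')
  moreover have "p * a > 0" using p by (simp add: a_def)
  ultimately show ?thesis using that[of "p * a"] by (simp only: power_add)
qed

text \<open>Once \<open>x ^ m\<close> is idempotent, \<open>x ^ (m * c) = x ^ m\<close> for all
  \<open>c > 0\<close>, so the product of the individual exponents serves all of
  \<open>X\<close>.\<close>

lemma finite_uniform_idempotent_power:
  fixes X :: "'m::monoid_mult set"
  assumes fin: "finite X" and pow: "\<And>x n. x \<in> X \<Longrightarrow> x ^ Suc n \<in> X"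
  obtains E where "E > 0" "\<And>x. x \<in> X \<Longrightarrow> x ^ E * x ^ E = x ^ E"
proof -
  have "\<exists>m>0. x ^ m * x ^ m = x ^ m" if "x \<in> X" for x
    using finite_powers_idempotent_power[OF fin pow[OF that]] by metis
  then obtain m where m: "\<And>x. x \<in> X \<Longrightarrow> m x > (0::nat) \<and> x ^ m x * x ^ m x = x ^ m x" by metis
  define E where "E = prod m X"
  have E: "E > 0" using m fin by (simp add: E_def prod_pos)
  have "x ^ E = x ^ m x" if x: "x \<in> X" for x
  proof -
    obtain c where c: "E = m x * c" using x fin by (metis E_def dvd_prodI dvd_def)
    then obtain c' where "c = Suc c'" using E by (cases c) auto
    moreover have "(x ^ m x) ^ Suc c' = x ^ m x" for c'
      using m[OF x] by (induction c') auto
    ultimately show ?thesis by (simp only: c power_mult)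
  qed
  thus ?thesis using that E m by simp
qed

text \<open>Acting as the identity off the states and for non-digits puts all actions into
  \<open>state_endos\<close>, which is finite even when the type of states is not.\<close>

definition digit_endo :: "nat \<Rightarrow> ('s, 'o) automaton \<Rightarrow> nat \<Rightarrow> 's endo" where
  "digit_endo k A j = Endo (\<lambda>s. if s \<in> aut_states A \<and> j < k then aut_trans A s j else s)"

lemma digit_endo_app:
  "endo_app (digit_endo k A j) s = (if s \<in> aut_states A \<and> j < k then aut_trans A s j else s)"
  by (simp add: digit_endo_def Endo_inverse)

definition state_endos :: "'s set \<Rightarrow> 's endo set" where
  "state_endos S = {f. (\<forall>s\<in>S. endo_app f s \<in> S) \<and> (\<forall>s. s \<notin> S \<longrightarrow> endo_app f s = s)}"

lemma finite_state_endos: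
  assumes "finite S"
  shows "finite (state_endos S)"
proof (rule finite_imageD)
  have "(\<lambda>f. restrict (endo_app f) S) ` state_endos S \<subseteq> S \<rightarrow>\<^sub>E S"
    by (auto simp: state_endos_def)
  thus "finite ((\<lambda>f. restrict (endo_app f) S) ` state_endos S)"
    using assms finite_PiE finite_subset by metis
  show "inj_on (\<lambda>f. restrict (endo_app f) S) (state_endos S)"
  proof (rule inj_onI)
    fix f g assume fg: "f \<in> state_endos S" "g \<in> state_endos S"
      and eq: "restrict (endo_app f) S = restrict (endo_app g) S"
    show "f = g"
    proof (rule endo_eqI)
      fix s show "endo_app f s = endo_app g s"
        using fg fun_cong[OF eq, of s] by (cases "s \<in> S") (auto simp: state_endos_def)
    qed
  qed
qed

lemma state_endos_one: "1 \<in> state_endos S"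
  and state_endos_times: "f \<in> state_endos S \<Longrightarrow> g \<in> state_endos S \<Longrightarrow> f * g \<in> state_endos S"
  by (auto simp: state_endos_def)

lemma state_endos_power: "f \<in> state_endos S \<Longrightarrow> f ^ n \<in> state_endos S"
  by (induction n) (auto simp: state_endos_one state_endos_times)

lemma digit_act_state_endos:
  assumes "k_automaton k A"
  shows "digit_act k (digit_endo k A) t n \<in> state_endos (aut_states A)"
proof (induction t arbitrary: n)
  case (Suc t)
  have "digit_endo k A j \<in> state_endos (aut_states A)" for j
    using assms by (auto simp: state_endos_def digit_endo_app k_automaton_def)
  thus ?case using Suc by (simp add: state_endos_times)
qed (simp add: state_endos_one)

lemma endo_power_fixed: "endo_app f s = s \<Longrightarrow> endo_app (f ^ n) s = s"
  by (induction n) auto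

text \<open>Prolongability makes the leading zeros of a \<open>t\<close>-digit expansion act
  trivially on the initial state.\<close>

lemma aut_run_base_expansion:
  assumes A: "k_automaton k A" and pr: "prolongable A" and "n < k ^ t"
  shows "aut_run A (aut_init A) (base_expansion k n) =
    endo_app (digit_act k (digit_endo k A) t n) (aut_init A)"
  using assms(3)
proof (induction t arbitrary: n)
  case 0
  thus ?case by (simp add: base_expansion.simps aut_run_def)
next
  case (Suc t)
  have k: "k \<ge> 2" and init: "aut_init A \<in> aut_states A" using A by (auto simp: k_automaton_def)
  show ?case
  proof (cases "n = 0")
    case True
    have "endo_app (digit_endo k A 0) (aut_init A) = aut_init A"
      using pr k by (simp add: digit_endo_app prolongable_def)
    thus ?thesis using True
      by (simp add: base_expansion.simps aut_run_def digit_act_zero endo_power_fixed)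
  next
    case False
    define s where "s = endo_app (digit_act k (digit_endo k A) t (n div k)) (aut_init A)"
    have "s \<in> aut_states A"
      using digit_act_state_endos[OF A, of t "n div k"] init by (simp add: s_def state_endos_def)
    moreover have "n div k < k ^ t" using Suc.prems by (simp add: less_mult_imp_div_less mult.commute)
    hence "aut_run A (aut_init A) (base_expansion k (n div k)) = s" unfolding s_def by (rule Suc.IH)
    moreover have "base_expansion k n = base_expansion k (n div k) @ [n mod k]"
      using False k by (simp add: base_expansion.simps[of k n])
    ultimately show ?thesis using k
      by (simp add: aut_run_append digit_endo_app flip: s_def) (simp add: aut_run_def)
  qed
qed

text \<open>The word is read as a number with as many digits as it has letters, leading zeros
  included.\<close>

lemma aut_run_digit_act:
  assumes A: "k_automaton k A" and w: "w \<in> lists {..<k}"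
  shows "\<exists>n. \<forall>s\<in>aut_states A. endo_app (digit_act k (digit_endo k A) (length w) n) s = aut_run A s w"
  using w
proof (induction w rule: rev_induct)
  case Nil
  show ?case by (simp add: aut_run_def)
next
  case (snoc j w)
  then obtain n where n: "\<And>s. s \<in> aut_states A \<Longrightarrow>
      endo_app (digit_act k (digit_endo k A) (length w) n) s = aut_run A s w" by auto
  have j: "j < k" using snoc.prems by auto
  have "endo_app (digit_act k (digit_endo k A) (length (w @ [j])) (n * k + j)) s = aut_run A s (w @ [j])"
    if s: "s \<in> aut_states A" for s
  proof -
    have "aut_run A s w \<in> aut_states A"
      using digit_act_state_endos[OF A, of "length w" n] s by (simp add: state_endos_def flip: n)
    thus ?thesis using j s n by (simp add: digit_endo_app aut_run_append) (simp add: aut_run_def)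
  qed
  thus ?case by blast
qed

theorem theoremB:
  fixes k :: nat
    and A :: "('s, complex) automaton"
    and a :: "nat \<Rightarrow> complex"
  assumes "k_automaton k A"
    and "strongly_connected k A"
    and "prolongable A"
    and "a = produced_seq k A"
  shows "\<exists>a_str a_uni :: nat \<Rightarrow> complex.
           (\<forall>n. a n = a_str n + a_uni n) \<and>
           rationally_almost_periodic a_str \<and> highly_gowers_uniform a_uni"
proof -
  define S where "S = aut_states A"
  define s0 where "s0 = aut_init A"
  define D where "D = digit_endo k A"
  have k: "k \<ge> 2" and S: "finite S" and s0: "s0 \<in> S"
    using assms(1) by (auto simp: k_automaton_def S_def s0_def)
  have act_S: "digit_act k D t n \<in> state_endos S" for t n
    unfolding D_def S_def by (rule digit_act_state_endos[OF assms(1)])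
  have D0: "endo_app (D 0) s0 = s0"
    using assms(3) k by (simp add: D_def digit_endo_app prolongable_def s0_def)
  obtain m where m: "m > 0" and idem: "\<And>x. x \<in> state_endos S \<Longrightarrow> x ^ m * x ^ m = x ^ m"
    using finite_uniform_idempotent_power[OF finite_state_endos[OF S] state_endos_power] by blast
  have m_Suc: "\<exists>m'. m = Suc m'" using m by (cases m) auto
  define Mon where "Mon = {digit_act k D (m * t) n | t n. True}"
  have Mon_S: "x \<in> state_endos S" if "x \<in> Mon" for x using that act_S by (auto simp: Mon_def)
  have Mon_mult: "x * y \<in> Mon" if xy: "x \<in> Mon" "y \<in> Mon" for x y
  proof -
    obtain t n u l where x: "x = digit_act k D (m * t) n" and y: "y = digit_act k D (m * u) l"
      using xy by (auto simp: Mon_def)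
    have "digit_act k D (m * (t + u)) (l * k ^ (m * t) + n mod k ^ (m * t)) = x * y"
      using k by (simp add: x y add_mult_distrib2 digit_act_append digit_act_mod)
    thus ?thesis unfolding Mon_def by (metis (mono_tags, lifting) mem_Collect_eq)
  qed
  have Mon_power: "x ^ Suc n \<in> Mon" if "x \<in> Mon" for x n
    using that by (induction n) (auto simp: Mon_mult)
  define i0 where "i0 = D 0 ^ m"
  have "digit_act k D (m * 1) 0 = i0" by (simp add: digit_act_zero i0_def)
  hence i0_Mon: "i0 \<in> Mon" unfolding Mon_def by (metis (mono_tags, lifting) mem_Collect_eq)
  have i0_idem: "i0 * i0 = i0"
    using idem[of "D 0"] act_S[of 1 0] by (simp add: i0_def)
  have i0_s0: "endo_app i0 s0 = s0" unfolding i0_def by (rule endo_power_fixed[OF D0])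
  have return: "\<exists>y\<in>Mon. endo_app y s = s0" if s: "s \<in> S" for s
  proof -
    obtain w where w: "w \<in> lists {..<k}" "aut_run A s w = s0"
      using assms(2) s s0 unfolding strongly_connected_def S_def by blast
    \<comment> \<open>Zeros appended as lowest digits are read last, when the state is already
      \<open>s0\<close>; they fill the length up to a multiple of \<open>m\<close>.\<close>
    define i where "i = length w * (m - 1)"
    obtain n where n: "endo_app (digit_act k D (length w) n) s = s0"
      using aut_run_digit_act[OF assms(1) w(1)] s w(2) by (auto simp: D_def S_def)
    have "i + length w = m * length w" using m by (cases m) (auto simp: i_def)
    hence "digit_act k D (m * length w) (n * k ^ i) = D 0 ^ i * digit_act k D (length w) n"
      using digit_act_append[of k D i "length w" n 0] k by (simp add: digit_act_zero)
    with n have "endo_app (digit_act k D (m * length w) (n * k ^ i)) s = s0"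
      by (simp add: endo_power_fixed[OF D0])
    thus ?thesis unfolding Mon_def by blast
  qed
  \<comment> \<open>The rank is minimised only among elements fixing \<open>s0\<close>;
    \<open>return\<close> later brings other elements back into this set.\<close>
  define P where "P = {f \<in> Mon. endo_app f s0 = s0 \<and> i0 * f = f \<and> f * i0 = f}"
  have "i0 \<in> P" using i0_Mon i0_idem i0_s0 by (simp add: P_def)
  then obtain f where f: "f \<in> P"
    and min: "\<And>g. g \<in> P \<Longrightarrow> card (endo_app f ` S) \<le> card (endo_app g ` S)"
    using ex_has_least_nat[of "\<lambda>f. f \<in> P" i0 "\<lambda>f. card (endo_app f ` S)"] by blast
  define f0 where "f0 = f ^ m"
  have f0_P: "f0 \<in> P"
  proof -
    obtain m' where m': "m = Suc m'" using m_Suc by blast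
    have "i0 * f ^ Suc m' = f ^ Suc m'" using f by (simp add: P_def mult.assoc[symmetric])
    moreover have "f ^ Suc m' * i0 = f ^ Suc m'" using f
      by (simp only: power_Suc2) (simp add: P_def mult.assoc)
    ultimately show ?thesis using f Mon_power
      by (auto simp: P_def f0_def m' endo_power_fixed simp del: power_Suc)
  qed
  hence f0: "f0 \<in> Mon" "endo_app f0 s0 = s0" "i0 * f0 = f0" "f0 * i0 = f0" by (auto simp: P_def)
  have f0_idem: "f0 * f0 = f0" using idem f Mon_S by (auto simp: f0_def P_def)
  have f0_card: "card (endo_app f0 ` S) \<le> card (endo_app f ` S)"
  proof (rule card_mono)
    obtain m' where m': "m = Suc m'" using m_Suc by blast
    have "endo_app (f ^ m') s \<in> S" if "s \<in> S" for s
      using that f Mon_S state_endos_power[of f S m'] by (auto simp: P_def state_endos_def)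
    thus "endo_app f0 ` S \<subseteq> endo_app f ` S" by (auto simp: f0_def m')
  qed (use S in simp)
  \<comment> \<open>An idempotent below \<open>f0\<close> has the same rank by minimality, hence the same image.\<close>
  have idem_eq: "u = f0" if u: "u \<in> Mon" "f0 * u = u" "u * f0 = u" "u * u = u" for u
  proof -
    have uS: "endo_app u s \<in> S" if "s \<in> S" for s using Mon_S[OF u(1)] that by (auto simp: state_endos_def)
    obtain y where y: "y \<in> Mon" "endo_app y (endo_app u s0) = s0" using return uS s0 by blast
    \<comment> \<open>As \<open>y\<close> returns \<open>endo_app u s0\<close> to \<open>s0\<close>,
      \<open>h\<close> lies in \<open>P\<close>, and its rank is at most that of
      \<open>u\<close>.\<close>
    define h where "h = f0 * (y * u)"
    have "h \<in> P"
    proof -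
      have "u * i0 = u" using u(3) f0(4) by (metis mult.assoc)
      thus ?thesis using y u f0 Mon_mult by (simp add: P_def h_def mult.assoc) (metis mult.assoc)
    qed
    hence "card (endo_app f0 ` S) \<le> card (endo_app h ` S)" using min f0_card order_trans by blast
    also have "endo_app h ` S = endo_app (f0 * y) ` (endo_app u ` S)"
      by (simp add: h_def image_image)
    also have "card \<dots> \<le> card (endo_app u ` S)" by (rule card_image_le) (use S in simp)
    finally have "card (endo_app f0 ` S) \<le> card (endo_app u ` S)" .
    moreover have "endo_app u ` S \<subseteq> endo_app f0 ` S"
      using uS u(2) by (metis endo_app_times image_subset_iff image_eqI)
    ultimately have im: "endo_app u ` S = endo_app f0 ` S"
      using S by (intro card_seteq) auto
    have "u * f0 = f0"
    proof (rule endo_eqI)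
      fix s
      show "endo_app (u * f0) s = endo_app f0 s"
      proof (cases "s \<in> S")
        case True
        hence "endo_app f0 s \<in> endo_app u ` S" using im by blast
        thus ?thesis using u(4) by (metis endo_app_times imageE)
      next
        case False
        thus ?thesis using Mon_S[OF u(1)] Mon_S[OF f0(1)] by (simp add: state_endos_def)
      qed
    qed
    thus ?thesis using u(3) by simp
  qed
  obtain t0 z0 where z0: "f0 = digit_act k D (m * t0) z0" using f0(1) by (auto simp: Mon_def)
  \<comment> \<open>The additional \<open>m\<close> zeros ensure \<open>L > 0\<close> even if
    \<open>t0 = 0\<close>, and are absorbed by \<open>i0 * f0 = f0\<close>. Reducing modulo
    \<open>k ^ L\<close> makes \<open>z\<close> a digit without changing its action.\<close>
  define L where "L = m * Suc t0"
  define T where "T = digit_act k D L"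
  define z where "z = (z0 * k ^ m) mod k ^ L"
  have L: "L > 0" using m by (simp add: L_def)
  have Tz: "T z = f0"
  proof -
    have "T z = digit_act k D (m + m * t0) (z0 * k ^ m + 0)"
      unfolding T_def z_def digit_act_mod by (simp add: L_def)
    also have "\<dots> = i0 * f0" using k by (subst digit_act_append) (auto simp: digit_act_zero i0_def z0)
    finally show ?thesis using f0 by simp
  qed
  have T0: "T 0 = i0"
  proof -
    have "i0 ^ Suc t = i0" for t using i0_idem by (induction t) auto
    thus ?thesis by (simp add: T_def digit_act_zero L_def power_mult i0_def del: power_Suc mult_Suc_right)
  qed
  have actT: "digit_act (k ^ L) T t n = digit_act k D (L * t) n" for t n
    unfolding T_def by (rule digit_act_base_power)
  have actT_Mon: "digit_act (k ^ L) T t n \<in> Mon" for t n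
  proof -
    have "digit_act (k ^ L) T t n = digit_act k D (m * (Suc t0 * t)) n"
      unfolding actT by (simp only: L_def mult.assoc)
    thus ?thesis unfolding Mon_def by blast
  qed
  \<comment> \<open>The exponent \<open>m\<close> already works, but \<open>m + m\<close> is at
    least \<open>2\<close>, as the form \<open>Suc (Suc E)\<close> demands.\<close>
  obtain E where E: "Suc (Suc E) = m + m" using m by (cases m) auto
  interpret idempotent_digit "k ^ L" z E T
  proof
    show "2 \<le> k ^ L" using k L self_le_power[of k L] by linarith
    show "z < k ^ L" using k by (simp add: z_def)
    show "T z * T z = T z" "T 0 * T z = T z" "T z * T 0 = T z" by (simp_all add: Tz T0 f0 f0_idem)
    show "(T z * digit_act (k ^ L) T t n * T z) ^ Suc (Suc E) = T z" for t n
    proof -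
      \<comment> \<open>This element is absorbed by \<open>f0\<close> on both sides, so its
        idempotent power \<open>g ^ m\<close> must be \<open>f0\<close> by
        \<open>idem_eq\<close>.\<close>
      define g where "g = f0 * digit_act (k ^ L) T t n * f0"
      have g: "g \<in> Mon" unfolding g_def by (intro Mon_mult f0 actT_Mon)
      obtain m' where m': "m = Suc m'" using m_Suc by blast
      have "f0 * g = g" "g * f0 = g" by (simp_all add: g_def mult.assoc f0_idem) (simp add: f0_idem flip: mult.assoc)
      hence "f0 * g ^ Suc m' = g ^ Suc m'" "g ^ Suc m' * f0 = g ^ Suc m'"
        by (simp add: mult.assoc[symmetric], simp only: power_Suc2 mult.assoc)
      moreover have "g ^ m * g ^ m = g ^ m" using idem Mon_S[OF g] by blast
      ultimately have "g ^ m = f0" using idem_eq[of "g ^ m"] Mon_power[OF g, of m'] by (simp add: m' del: power_Suc)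
      thus ?thesis by (simp only: Tz E power_add f0_idem flip: g_def)
    qed
    show "finite {digit_act (k ^ L) T t n | t n. True}"
      by (rule finite_subset[OF _ finite_state_endos[OF S]]) (auto intro: Mon_S actT_Mon)
  qed
  \<comment> \<open>The output function is surely bounded only on the finite set of states, hence
    the default \<open>0\<close> elsewhere.\<close>
  define F where "F r = (if endo_app r s0 \<in> S then aut_out A (endo_app r s0) else 0)" for r
  have "cmod (F r) \<le> (\<Sum>s\<in>S. cmod (aut_out A s))" for r
    using S by (auto simp: F_def intro!: member_le_sum sum_nonneg)
  moreover have "a n = F (rr n)" for n
  proof -
    have "n < k ^ (L * n)" using less_W_power[of n] by (simp add: power_mult)
    hence "a n = aut_out A (endo_app (digit_act k D (L * n) n) s0)"
      unfolding assms(4) produced_seq_def D_def s0_def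
      by (subst aut_run_base_expansion[OF assms(1,3)]) auto
    \<comment> \<open>Since \<open>f0\<close> fixes \<open>s0\<close>, the factor \<open>e\<close>
      in \<open>rr n\<close> does not change the state reached.\<close>
    also have "endo_app (digit_act k D (L * n) n) s0 = endo_app (rr n) s0"
      by (simp add: rr_def actT Tz f0)
    finally show ?thesis
      using Mon_S[OF Mon_mult[OF actT_Mon[of n n] f0(1)]] s0
      by (simp add: F_def rr_def Tz state_endos_def)
  qed
  ultimately show ?thesis using structured_uniform_decomposition[of F] by metis
qed

end
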